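(* Let $L$ and $n$ be positive integers. The map $\rho:B\mapsto(\rho_N(B),\rho_Q(B))$ is a bijection \[\rho:\ \mathcal M(L,n)\longrightarrow\bigcup_\mu\mathrm{MLQ}_0(\mu,n)\times\mathrm{SSYT}(\mu',L),\] where the union is over partitions $\mu$, and it satisfies $x^B=x^{\rho_N(B)}$ for all $B\in\mathcal M(L,n)$.
   Context: Partitions and tableaux. $\mu'$ is the conjugate of $\mu$, $\ell(\mu)$ its length. Diagrams are in French notation (row 1 at bottom). A semistandard Young tableau (SSYT) has entries weakly increasing left to right along rows and strictly increasing up columns; $\mathrm{SSYT}(\nu,L)$ is the set of SSYT of shape $\nu$ with entries in $[L]$. Binary matrices and multiline queues. $\mathcal M(L,n)$ is the set of tuples $B=(B_1,\dots,B_L)$ of subsets of $[n]$, drawn as a grid with rows $1..L$ bottom to top, columns $1..n$ left to right, ball in $(r,j)$ iff $j\in B_r$; weight $x^B=\prod_r\prod_{b\in B_r}x_b$. For a partition $\mu$ with $n\ge\ell(\mu)$, $\mathrm{MLQ}(\mu,n)$ is the set of tuples $(B_1,\dots,B_{\mu_1})$ of subsets of $[n]$ with $|B_j|=\mu'_j$; tuples with empty top rows are identified with the tuple obtained by deleting those rows. $\mathrm{cw}(B)$ scans columns left to right, each column top to bottom, recording row numbers of balls. Major index. For $M\in\mathrm{MLQ}(\mu,n)$, $L'=\mu_1$: for $r=L',\dots,2$, unlabelled balls of row $r$ get label $r$; then the balls of row $r$ in decreasing label order (left to right among ties) are each paired with the first unlabelled ball of row $r-1$ weakly to the right, cyclically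 modulo $n$, which receives the same label; the pairing wraps if the lower ball lies strictly left of the upper ball. $\operatorname{maj}(M)=\sum(\ell(p)-r(p)+1)$ over wrapping pairings, $r(p)$ the upper row, $\ell(p)$ the label. $\mathrm{MLQ}_0(\mu,n)=\{M\in\mathrm{MLQ}(\mu,n):\operatorname{maj}(M)=0\}$. Collapsing. For a word $w$ and $i\ge1$, $\mathrm{Par}_i(w)$ writes "(" for each $i+1$ and ")" for each $i$ (left to right) and iteratively matches a "(" with a ")" to its right when adjacent or separated only by matched parentheses. $e_i^\star(B)$ moves every ball of row $i+1$ whose letter in $\mathrm{cw}(B)$ is unmatched in $\mathrm{Par}_i(\mathrm{cw}(B))$ down to row $i$ in the same column. Products act right to left; $e^\star_{[a,b]}=e^\star_ae^\star_{a+1}\cdots e^\star_b$; $\rho_N(B)=e^\star_{[1,L-1]}\cdots e^\star_{[1,2]}e^\star_{[1,1]}(B)$. With $N^{(k)}$ the bottom $k$ rows of $e^\star_{[1,k-1]}\cdots e^\star_{[1,1]}(B)$ ($1\le k\le L$) and $N^{(0)}$ empty, $\rho_Q(B)$ is the filling whose row $r$ contains $|N^{(i)}_r|-|N^{(i-1)}_r|$ entries $i$ for $i=1,\dots,L$ (with $|N^{(i-1)}_i|=0$), in weakly increasing order. *)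

theory Defs
  imports Main
begin

definition is_partition :: "nat list \<Rightarrow> bool" where
  "is_partition mu \<longleftrightarrow> sorted_wrt (\<ge>) mu \<and> 0 \<notin> set mu"

definition first_part :: "nat list \<Rightarrow> nat" where
  "first_part mu = (case mu of [] \<Rightarrow> 0 | a # _ \<Rightarrow> a)"

definition conj_part :: "nat list \<Rightarrow> nat list" where
  "conj_part mu = map (\<lambda>j. length (filter (\<lambda>p. j \<le> p) mu)) [1..<first_part mu + 1]"

text \<open>A filling is a list of rows, row 1 (bottom, French notation) first.
  SSYT(nu, L): rows weakly increasing, columns strictly increasing upwards, entries in [L].\<close>
definition SSYT :: "nat list \<Rightarrow> nat \<Rightarrow> nat list list set" where
  "SSYT nu L = {T. map length T = nu \<and>
      (\<forall>row \<in> set T. sorted row \<and> set row \<subseteq> {1..L}) \<and>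
      (\<forall>r c. Suc r < length T \<and> c < length (T ! Suc r) \<longrightarrow> T ! r ! c < T ! Suc r ! c)}"

text \<open>A tuple (B_1,...,B_L) of subsets is a list of length L; row r is the entry at index r-1.\<close>
definition binmat :: "nat \<Rightarrow> nat \<Rightarrow> nat set list set" where
  "binmat L n = {B. length B = L \<and> (\<forall>S \<in> set B. S \<subseteq> {1..n})}"

definition weight :: "(nat \<Rightarrow> 'a::comm_monoid_mult) \<Rightarrow> nat set list \<Rightarrow> 'a" where
  "weight x B = (\<Prod>r \<leftarrow> B. \<Prod>b \<in> r. x b)"

text \<open>Deleting empty top rows (tuples with empty top rows are identified with the
  tuple obtained by deleting those rows).\<close>
definition strip_top :: "'a set list \<Rightarrow> 'a set list" where
  "strip_top B = rev (dropWhile (\<lambda>S. S = {}) (rev B))"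

definition MLQ :: "nat list \<Rightarrow> nat \<Rightarrow> nat set list set" where
  "MLQ mu n = (if length mu \<le> n then
     {M. length M = first_part mu \<and>
         (\<forall>j < length M. M ! j \<subseteq> {1..n} \<and> card (M ! j) = conj_part mu ! j)}
     else {})"

text \<open>Pair the balls (column, label) of row r, in the given order, with the first
  still-unlabelled ball of the row below weakly to the right, cyclically. Returns the
  labels given to the lower row and the contribution of wrapping pairings to maj.\<close>
fun pair_step :: "nat \<Rightarrow> nat set \<Rightarrow> (nat \<times> nat) list \<Rightarrow> (nat \<times> nat) list \<times> nat" where
  "pair_step r avail [] = ([], 0)"
| "pair_step r avail ((c, l) # bs) =
    (let j = (if \<exists>x \<in> avail. c \<le> x then Min {x \<in> avail. c \<le> x} else Min avail);
         w = (if j < c then l - r + 1 else 0);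
         (rest, m) = pair_step r (avail - {j}) bs
     in ((j, l) # rest, w + m))"

fun maj_aux :: "nat set list \<Rightarrow> nat \<Rightarrow> (nat \<Rightarrow> nat option) \<Rightarrow> nat" where
  "maj_aux M 0 asg = 0"
| "maj_aux M (Suc 0) asg = 0"
| "maj_aux M (Suc (Suc k)) asg =
    (let r = Suc (Suc k);
         lab = (\<lambda>c. case asg c of Some l \<Rightarrow> l | None \<Rightarrow> r);
         balls = concat (map (\<lambda>l. [(c, l). c \<leftarrow> sorted_list_of_set (M ! (r - 1)), lab c = l])
                             (rev [r..<length M + 1]));
         (pairs, w) = pair_step r (M ! (r - 2)) balls
     in w + maj_aux M (Suc k) (map_of pairs))"

definition maj :: "nat set list \<Rightarrow> nat" where
  "maj M = maj_aux M (length M) Map.empty"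

definition MLQ0 :: "nat list \<Rightarrow> nat \<Rightarrow> nat set list set" where
  "MLQ0 mu n = {M \<in> MLQ mu n. maj M = 0}"

text \<open>Column reading: columns 1..n left to right, each column top to bottom; each entry
  is (row, column) of a ball; the column word cw(B) is the list of row numbers.\<close>
definition cw_cells :: "nat \<Rightarrow> nat set list \<Rightarrow> (nat \<times> nat) list" where
  "cw_cells n B = concat (map (\<lambda>j. [(r, j). r \<leftarrow> rev [1..<length B + 1], j \<in> B ! (r - 1)])
                               [1..<n + 1])"

definition cw :: "nat \<Rightarrow> nat set list \<Rightarrow> nat list" where
  "cw n B = map fst (cw_cells n B)"

text \<open>Par_i: the parenthesis word, as a list of (position, is-open-parenthesis).
  One matching step removes an adjacent pair "(" ")" among the still unmatched parentheses
  (being separated only by matched parentheses = adjacent after removing matched ones).\<close>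
definition par_word :: "nat \<Rightarrow> nat list \<Rightarrow> (nat \<times> bool) list" where
  "par_word i w = [(p, w ! p = Suc i). p \<leftarrow> [0..<length w], w ! p = i \<or> w ! p = Suc i]"

fun match_step :: "(nat \<times> bool) list \<Rightarrow> (nat \<times> bool) list" where
  "match_step ((p, True) # (q, False) # xs) = xs"
| "match_step (x # xs) = x # match_step xs"
| "match_step [] = []"

text \<open>Iterating the matching step until nothing changes (length-many steps suffice).\<close>
definition unmatched :: "nat \<Rightarrow> nat list \<Rightarrow> (nat \<times> bool) list" where
  "unmatched i w = (let ps = par_word i w in (match_step ^^ length ps) ps)"

definition estar :: "nat \<Rightarrow> nat \<Rightarrow> nat set list \<Rightarrow> nat set list" where
  "estar n i B =
    (let cells = cw_cells n B;
         mv = {snd (cells ! p) | p. (p, True) \<in> set (unmatched i (map fst cells))}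
     in B[i - 1 := B ! (i - 1) \<union> mv, i := B ! i - mv])"

definition estar_int :: "nat \<Rightarrow> nat \<Rightarrow> nat \<Rightarrow> nat set list \<Rightarrow> nat set list" where
  "estar_int n a b B = foldr (estar n) [a..<b + 1] B"

definition collapse_upto :: "nat \<Rightarrow> nat \<Rightarrow> nat set list \<Rightarrow> nat set list" where
  "collapse_upto n k B = fold (\<lambda>m. estar_int n 1 m) [1..<k] B"

definition rhoN :: "nat \<Rightarrow> nat set list \<Rightarrow> nat set list" where
  "rhoN n B = collapse_upto n (length B) B"

definition Ncard :: "nat \<Rightarrow> nat set list \<Rightarrow> nat \<Rightarrow> nat \<Rightarrow> nat" where
  "Ncard n B k r = (if 1 \<le> r \<and> r \<le> k then card (collapse_upto n k B ! (r - 1)) else 0)"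

text \<open>The filling rho_Q(B) with rows 1..L; empty top rows are deleted so that it is a
  filling of a partition shape.\<close>
definition rhoQ_rows :: "nat \<Rightarrow> nat set list \<Rightarrow> nat list list" where
  "rhoQ_rows n B = (let L = length B in
     map (\<lambda>r. concat (map (\<lambda>i. replicate (Ncard n B i r - Ncard n B (i - 1) r) i) [1..<L + 1]))
         [1..<L + 1])"

definition rhoQ :: "nat \<Rightarrow> nat set list \<Rightarrow> nat list list" where
  "rhoQ n B = rev (dropWhile (\<lambda>row. row = []) (rev (rhoQ_rows n B)))"

definition rho :: "nat \<Rightarrow> nat set list \<Rightarrow> nat set list \<times> nat list list" where
  "rho n B = (strip_top (rhoN n B), rhoQ n B)"

definition rho_codomain :: "nat \<Rightarrow> nat \<Rightarrow> (nat set list \<times> nat list list) set" where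
  "rho_codomain L n = (\<Union>mu \<in> {mu. is_partition mu}. MLQ0 mu n \<times> SSYT (conj_part mu) L)"

end

theory Submission
  imports Defs
begin

text \<open>
  Let \<open>cnt S j\<close> be the number of balls of the row \<open>S\<close> weakly right of column \<open>j\<close>, and order rows by
  pointwise comparison of \<open>cnt\<close>. The balls moved by \<open>e\<^sub>i\<^sup>\<star>\<close> are characterised by counts alone
  (\<open>is_excess\<close>), and collapsing one more row is an insertion in the style of dual RSK whose result
  interlaces, in this order, with the configuration it was inserted into. Hence the row sizes recorded
  by \<open>rhoQ\<close> form interlacing partitions, that is, a semistandard tableau. Conversely a single exchange
  between two rows is undone by moving up the rightmost unmatched balls of the lower row; their number
  is the only information needed, and the tableau supplies it. Finally \<open>maj\<close> vanishes exactly when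
  consecutive rows are comparable.
\<close>

section \<open>Unmatched balls of two adjacent rows\<close>

text \<open>An exchange between rows \<open>C\<close> and \<open>A\<close> replaces them by
  \<open>C - U\<close> and \<open>A \<union> U\<close> and forgets \<open>U\<close>. The way back
  rests on rewriting the conditions on \<open>U\<close> in terms of these two output rows alone: for
  each admissible size they then have exactly one solution, which depends only on the rows and the
  size. Exchanges have to be undone from the bottom row upwards, because the row carried down by an
  insertion is hidden until everything below it has been undone. In surjectivity the two halves of
  the interlacing of sizes do different work: one leaves enough slack for the prescribed number of
  balls to move, the other, together with the maximality of \<open>U\<close>, makes the recovered
  rows a chain again. Empty rows are a separate obstacle: the theorem identifies tuples that differ
  by empty top rows, whereas the insertion argument needs a fixed number of rows. The bijection is
  therefore proved for exactly \<open>L\<close> rows and composed with deletion of empty top rows.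
  The latter is onto because strictness along columns bounds the number of nonempty rows of a
  tableau with entries up to \<open>L\<close>.\<close>

definition cnt :: "nat set \<Rightarrow> nat \<Rightarrow> nat" where
  "cnt S j = card (S \<inter> {j..})"

definition dominated :: "nat set \<Rightarrow> nat set \<Rightarrow> bool" where
  "dominated C A \<longleftrightarrow> (\<forall>j. cnt C j \<le> cnt A j)"

lemma cnt_0 [simp]: "cnt S 0 = card S"
  by (simp add: cnt_def)

lemma cnt_Suc: "finite S \<Longrightarrow> cnt S j = (if j \<in> S then Suc (cnt S (Suc j)) else cnt S (Suc j))"
proof -
  assume fin: "finite S"
  have "S \<inter> {j..} = (if j \<in> S then insert j (S \<inter> {Suc j..}) else S \<inter> {Suc j..})"
    by (auto simp: Suc_le_eq le_less)
  then show ?thesis using fin by (simp add: cnt_def)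
qed

lemma cnt_antimono: "finite S \<Longrightarrow> i \<le> j \<Longrightarrow> cnt S j \<le> cnt S i"
  unfolding cnt_def by (intro card_mono) auto

lemma cnt_mono: "finite S \<Longrightarrow> R \<subseteq> S \<Longrightarrow> cnt R j \<le> cnt S j"
  unfolding cnt_def by (intro card_mono) auto

lemma cnt_Un: "finite A \<Longrightarrow> finite U \<Longrightarrow> A \<inter> U = {} \<Longrightarrow> cnt (A \<union> U) j = cnt A j + cnt U j"
  unfolding cnt_def by (subst card_Un_disjoint [symmetric]) (auto simp: Int_Un_distrib2)

lemma cnt_Diff: "finite C \<Longrightarrow> U \<subseteq> C \<Longrightarrow> cnt (C - U) j + cnt U j = cnt C j"
  using cnt_Un [of "C - U" U j] by (simp add: finite_subset Un_absorb2 Diff_disjoint Int_commute)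

lemma cnt_eqI:
  assumes "finite U" "finite V" and eq: "\<And>j. cnt U j = cnt V j"
  shows "U = V"
proof -
  have "j \<in> U \<longleftrightarrow> j \<in> V" for j
    using cnt_Suc [OF assms(1), of j] cnt_Suc [OF assms(2), of j] eq [of j] eq [of "Suc j"]
    by (auto split: if_splits)
  then show ?thesis by blast
qed

text \<open>Between consecutive elements of \<open>U\<close> its count is constant, so against an
  antitone bound only the elements of \<open>U\<close> need checking. These are the places where an
  excess set satisfies an equation.\<close>

lemma cnt_le_antimono:
  assumes "finite U" and "\<And>i. i \<in> U \<Longrightarrow> cnt U i \<le> f i" and "\<And>i. j \<le> i \<Longrightarrow> f i \<le> f j"
  shows "cnt U j \<le> f j"
proof (cases "U \<inter> {j..} = {}")
  case True
  then show ?thesis by (simp add: cnt_def)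
next
  case False
  define i where "i = Min (U \<inter> {j..})"
  have i: "i \<in> U" "j \<le> i" "U \<inter> {j..} = U \<inter> {i..}"
    using Min_in [of "U \<inter> {j..}"] Min_le [of "U \<inter> {j..}"] False assms(1)
    by (fastforce simp: i_def)+
  then have "cnt U j = cnt U i" by (simp add: cnt_def)
  also have "\<dots> \<le> f i" using i assms by blast
  also have "\<dots> \<le> f j" using i assms by blast
  finally show ?thesis .
qed

lemma dominated_trans: "dominated A B \<Longrightarrow> dominated B C \<Longrightarrow> dominated A C"
  by (meson dominated_def order_trans)

lemma dominated_card: "dominated A B \<Longrightarrow> card A \<le> card B"
  by (metis cnt_0 dominated_def)

lemma dominated_empty [simp]: "dominated {} A"
  by (simp add: dominated_def cnt_def)

text \<open>The count conditions say that \<open>cnt U j\<close> is the maximum of 0 and all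
  \<open>cnt C i - cnt A i\<close> with \<open>i \<ge> j\<close>: it bounds these differences, and
  it grows only where it attains one.\<close>

definition is_excess :: "nat set \<Rightarrow> nat set \<Rightarrow> nat set \<Rightarrow> bool" where
  "is_excess C A U \<longleftrightarrow> U \<subseteq> C \<and> (\<forall>j. cnt C j \<le> cnt A j + cnt U j) \<and>
     (\<forall>j\<in>U. cnt C j = cnt A j + cnt U j)"

definition excess :: "nat set \<Rightarrow> nat set \<Rightarrow> nat set" where
  "excess C A = (THE U. is_excess C A U)"

lemma is_excess_finite: "finite C \<Longrightarrow> is_excess C A U \<Longrightarrow> finite U"
  by (meson finite_subset is_excess_def)

lemma is_excess_unique:
  assumes "finite C" and U: "is_excess C A U" and V: "is_excess C A V"
  shows "U = V"
proof -
  have le: "cnt U j \<le> cnt V j" if U: "is_excess C A U" and V: "is_excess C A V" for U V j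
  proof (rule cnt_le_antimono)
    have fin: "finite U" "finite V"
      using U V assms(1) is_excess_finite by blast+
    show "finite U" by fact
    show "cnt V i \<le> cnt V j" if "j \<le> i" for i using fin that by (simp add: cnt_antimono)
    show "cnt U i \<le> cnt V i" if "i \<in> U" for i
      using U V that unfolding is_excess_def by (metis nat_add_left_cancel_le)
  qed
  have "finite U" "finite V"
    using assms is_excess_finite by blast+
  then show ?thesis by (rule cnt_eqI) (rule le_antisym [OF le [OF U V] le [OF V U]])
qed

text \<open>Past a common column \<open>cnt C\<close> falls by one but \<open>cnt A + cnt U\<close>
  by two, so equality there would break the bound in the next column.\<close>

lemma is_excess_disjoint:
  assumes "finite C" "finite A" "is_excess C A U"
  shows "U \<inter> A = {}"
proof -
  have "j \<notin> A" if "j \<in> U" for j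
  proof
    assume "j \<in> A"
    have "finite U" "j \<in> C" using assms that is_excess_finite by (auto simp: is_excess_def)
    moreover have "cnt C j = cnt A j + cnt U j" "cnt C (Suc j) \<le> cnt A (Suc j) + cnt U (Suc j)"
      using assms(3) that by (auto simp: is_excess_def)
    ultimately show False
      using cnt_Suc [of C j] cnt_Suc [of A j] cnt_Suc [of U j] assms \<open>j \<in> A\<close> that by simp
  qed
  then show ?thesis by blast
qed

section \<open>Bracket cancellation from right to left\<close>

fun cancel :: "('a \<times> bool) list \<Rightarrow> ('a \<times> bool) list" where
  "cancel [] = []"
| "cancel ((p, False) # xs) = (p, False) # cancel xs"
| "cancel ((p, True) # xs) = (case cancel xs of (q, False) # ys \<Rightarrow> ys | ys \<Rightarrow> (p, True) # ys)"

definition col_word :: "nat set \<Rightarrow> nat set \<Rightarrow> nat \<Rightarrow> (nat \<times> bool) list" where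
  "col_word C A j = (if j \<in> C then [(j, True)] else []) @ (if j \<in> A then [(j, False)] else [])"

text \<open>What survives is a block \<open>F\<close> of closing brackets followed by a block
  \<open>G\<close> of opening ones. The balance equation carries the induction: once
  \<open>F\<close> is empty it turns the length of \<open>G\<close> into a difference of counts,
  which is the equality demanded of an unmatched ball.\<close>

lemma cancel_columns:
  fixes C A n
  defines "W \<equiv> \<lambda>k. cancel (concat (map (col_word C A) [k..<Suc n]))"
  assumes "finite C" "finite A" "C \<subseteq> {..n}" "A \<subseteq> {..n}"
  shows "k \<le> Suc n \<Longrightarrow> \<exists>F G. W k = map (\<lambda>x. (x, False)) F @ map (\<lambda>x. (x, True)) G \<and>
     distinct G \<and> set G \<subseteq> C \<inter> {k..} \<and> length F + cnt C k = cnt A k + length G \<and>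
     (\<forall>j\<ge>k. cnt C j \<le> cnt A j + cnt (set G) j) \<and>
     (\<forall>j\<in>set G. cnt C j = cnt A j + cnt (set G) j)"
proof (induction rule: inc_induct)
  case base
  have "C \<inter> {j..} = {}" "A \<inter> {j..} = {}" if "Suc n \<le> j" for j
    using assms(4,5) that by force+
  then show ?case by (intro exI [of _ "[]"]) (auto simp: W_def cnt_def)
next
  case (step k)
  then obtain F G where FG: "W (Suc k) = map (\<lambda>x. (x, False)) F @ map (\<lambda>x. (x, True)) G"
    "distinct G" "set G \<subseteq> C \<inter> {Suc k..}" "length F + cnt C (Suc k) = cnt A (Suc k) + length G"
    "\<forall>j\<ge>Suc k. cnt C j \<le> cnt A j + cnt (set G) j"
    "\<forall>j\<in>set G. cnt C j = cnt A j + cnt (set G) j"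
    by blast
  have cC: "cnt C k = (if k \<in> C then Suc (cnt C (Suc k)) else cnt C (Suc k))"
    and cA: "cnt A k = (if k \<in> A then Suc (cnt A (Suc k)) else cnt A (Suc k))"
    using cnt_Suc assms(2,3) by blast+
  have cG: "cnt (set G) k = length G" "cnt (set G) (Suc k) = length G" "k \<notin> set G"
  proof -
    have "set G \<inter> {k..} = set G" "set G \<inter> {Suc k..} = set G" using FG(3) by auto
    then show "cnt (set G) k = length G" "cnt (set G) (Suc k) = length G"
      using FG(2) by (simp_all add: cnt_def distinct_card)
  qed (use FG(3) in auto)
  have split: "(\<forall>j\<ge>k. P j) \<longleftrightarrow> P k \<and> (\<forall>j\<ge>Suc k. P j)" for P
    by (auto simp: Suc_le_eq) (metis le_less)
  have upt: "[k..<Suc n] = k # [Suc k..<Suc n]" using step(2) by (simp add: upt_conv_Cons)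
  \<comment> \<open>The closing bracket of column \<open>k\<close> joins first: the opening bracket
    of the same column stands to its left and may be matched with it.\<close>
  define F' where "F' = (if k \<in> A then k # F else F)"
  have W: "W k = cancel ((if k \<in> C then [(k, True)] else []) @ 
      (if k \<in> A then [(k, False)] else []) @ concat (map (col_word C A) [Suc k..<Suc n]))"
    by (simp only: W_def upt list.map concat.simps col_word_def append_assoc)
  have F': "cancel ((if k \<in> A then [(k, False)] else []) @ concat (map (col_word C A) [Suc k..<Suc n]))
     = map (\<lambda>x. (x, False)) F' @ map (\<lambda>x. (x, True)) G"
    using FG(1) by (simp add: W_def F'_def del: upt_Suc)
  show ?case
  proof (cases "k \<in> C \<and> F' = []")
    \<comment> \<open>Either column \<open>k\<close> has no opening bracket or a closing one is
      available for it; the surviving opening brackets stay the same.\<close>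
    case False
    define F'' where "F'' = (if k \<in> C then tl F' else F')"
    have "W k = map (\<lambda>x. (x, False)) F'' @ map (\<lambda>x. (x, True)) G"
      using False F' by (cases F') (auto simp: W F''_def simp del: upt_Suc)
    moreover have "length F'' + cnt C k = cnt A k + length G"
      using False FG(4) unfolding cA cC F''_def F'_def by (cases F) (auto split: if_splits)
    moreover have "\<forall>j\<ge>k. cnt C j \<le> cnt A j + cnt (set G) j"
      unfolding split [of "\<lambda>j. cnt C j \<le> cnt A j + cnt (set G) j"]
      using FG(5) cG(1) calculation(2) by auto
    moreover have "set G \<subseteq> C \<inter> {k..}" using FG(3) by auto
    ultimately show ?thesis using FG(2,6) by blast
  next
    \<comment> \<open>The opening bracket of column \<open>k\<close> survives, and balance with
      \<open>F = []\<close> gives the equality at \<open>k\<close>.\<close>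
    case True
    then have "W k = map (\<lambda>x. (x, False)) [] @ map (\<lambda>x. (x, True)) (k # G)"
      using F' by (cases G) (auto simp: W simp del: upt_Suc)
    moreover have nA: "k \<notin> A" "F = []" using True by (auto simp: F'_def split: if_splits)
    moreover have ck: "cnt (set (k # G)) j = cnt (set G) j" if "Suc k \<le> j" for j
      using that by (simp add: cnt_def)
    moreover have ck': "cnt (set (k # G)) k = Suc (length G)"
      using cG cnt_Suc [of "set (k # G)" k] ck [of "Suc k"] by simp
    moreover have "\<forall>j\<in>set (k # G). cnt C j = cnt A j + cnt (set (k # G)) j"
    proof (rule ballI)
      fix j assume "j \<in> set (k # G)"
      then consider "j = k" | "j \<in> set G" "Suc k \<le> j" using FG(3) by auto
      then show "cnt C j = cnt A j + cnt (set (k # G)) j"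
        by cases (use FG(4,6) nA ck ck' cC cA True in auto)
    qed
    moreover have "\<forall>j\<ge>k. cnt C j \<le> cnt A j + cnt (set (k # G)) j"
      unfolding split [of "\<lambda>j. cnt C j \<le> cnt A j + cnt (set (k # G)) j"]
      using FG(4,5) ck ck' nA cC cA True by simp
    moreover have "distinct (k # G)" "set (k # G) \<subseteq> C \<inter> {k..}" using FG(2,3) True by auto
    moreover have "length [] + cnt C k = cnt A k + length (k # G)"
      using True FG(4) cC cA nA by simp
    ultimately show ?thesis by blast
  qed
qed

lemma is_excess_cancel:
  assumes "C \<subseteq> {..n}" "A \<subseteq> {..n}"
  shows "is_excess C A {j. (j, True) \<in> set (cancel (concat (map (col_word C A) [0..<Suc n])))}"
proof -
  have fin: "finite C" "finite A" using assms by (simp_all add: finite_subset [OF _ finite_atMost])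
  obtain F G where FG: "cancel (concat (map (col_word C A) [0..<Suc n])) =
      map (\<lambda>x. (x, False)) F @ map (\<lambda>x. (x, True)) G" "set G \<subseteq> C"
     "\<forall>j. cnt C j \<le> cnt A j + cnt (set G) j"
     "\<forall>j\<in>set G. cnt C j = cnt A j + cnt (set G) j"
    using cancel_columns [OF fin assms, of 0] by (metis le0 le_infE)
  have "{j. (j, True) \<in> set (cancel (concat (map (col_word C A) [0..<Suc n])))} = set G"
    unfolding FG(1) by auto
  then show ?thesis using FG(2-4) unfolding is_excess_def by metis
qed

lemma excess_eqI: "finite C \<Longrightarrow> is_excess C A U \<Longrightarrow> excess C A = U"
  unfolding excess_def by (rule the_equality) (assumption, rule is_excess_unique)

lemma is_excess_excess:
  assumes "finite C" "finite A"
  shows "is_excess C A (excess C A)"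
proof -
  have "C \<subseteq> {..Max (C \<union> A)}" "A \<subseteq> {..Max (C \<union> A)}" using assms by auto
  from is_excess_cancel [OF this] show ?thesis using excess_eqI [OF assms(1)] by metis
qed

lemma excess_props:
  assumes "finite C" "finite A"
  shows "excess C A \<subseteq> C" "finite (excess C A)" "excess C A \<inter> A = {}"
    "cnt C j \<le> cnt A j + cnt (excess C A) j"
    "j \<in> excess C A \<Longrightarrow> cnt C j = cnt A j + cnt (excess C A) j"
    "dominated (C - excess C A) A"
proof -
  note ex = is_excess_excess [OF assms]
  show sub: "excess C A \<subseteq> C" and le: "cnt C j \<le> cnt A j + cnt (excess C A) j" for j
    using ex by (auto simp: is_excess_def)
  show "j \<in> excess C A \<Longrightarrow> cnt C j = cnt A j + cnt (excess C A) j"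
    using ex by (auto simp: is_excess_def)
  show "finite (excess C A)" using ex assms is_excess_finite by blast
  show "excess C A \<inter> A = {}" using ex assms is_excess_disjoint by blast
  show "dominated (C - excess C A) A"
    unfolding dominated_def
  proof
    fix j
    show "cnt (C - excess C A) j \<le> cnt A j"
      using cnt_Diff [OF assms(1) sub, of j] le [of j] by linarith
  qed
qed

text \<open>On the new excess \<open>V\<close> one has
  \<open>cnt A + cnt U = cnt A' + cnt V\<close>, so \<open>dominated A A'\<close> forces
  \<open>cnt V \<le> cnt U\<close>: weakly right of any column, a row passes on no more balls than
  it received. This is the less obvious half of interlacing.\<close>

lemma dominated_Un_excess:
  assumes fin: "finite A" "finite U" "finite A'" and "A \<inter> U = {}" and "dominated A A'"
  shows "dominated A (A \<union> U - excess (A \<union> U) A')"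
proof -
  define V where "V = excess (A \<union> U) A'"
  have V: "V \<subseteq> A \<union> U" "finite V" "\<And>j. j \<in> V \<Longrightarrow> cnt (A \<union> U) j = cnt A' j + cnt V j"
    using excess_props [of "A \<union> U" A'] fin by (auto simp: V_def)
  have Un: "cnt (A \<union> U) j = cnt A j + cnt U j" for j using assms cnt_Un by blast
  have "cnt V j \<le> cnt U j" for j
  proof (rule cnt_le_antimono)
    fix i assume "i \<in> V"
    then show "cnt V i \<le> cnt U i" using V(3) [of i] Un [of i] assms(5) unfolding dominated_def
      by (metis add_le_cancel_left add_le_mono1)
  qed (use V fin cnt_antimono in auto)
  then have "cnt A j \<le> cnt (A \<union> U - V) j" for j
    using cnt_Diff [of "A \<union> U" V j] V(1) fin Un [of j]
    by (metis add_le_cancel_right finite_UnI nat_add_left_cancel_le)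
  then show ?thesis by (simp add: dominated_def V_def)
qed

section \<open>Row insertion\<close>

text \<open>Configurations are listed from the top row down here, opposite to the order in \<open>binmat\<close>.\<close>

fun insert_row :: "nat set \<Rightarrow> nat set list \<Rightarrow> nat set list" where
  "insert_row X [] = [X]"
| "insert_row X (A # As) = (X - excess X A) # insert_row (A \<union> excess X A) As"

text \<open>Generic in the order, so that interlacing of rows under \<open>dominated\<close>
  transfers to row sizes under \<open>\<le>\<close>, where it is the horizontal strip
  condition.\<close>

fun interlaced :: "('a \<Rightarrow> 'a \<Rightarrow> bool) \<Rightarrow> 'a list \<Rightarrow> 'a list \<Rightarrow> bool" where
  "interlaced le [d] [] \<longleftrightarrow> True"
| "interlaced le (d # e # ds) (a # as) \<longleftrightarrow> le d a \<and> le a e \<and> interlaced le (e # ds) as"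
| "interlaced le _ _ \<longleftrightarrow> False"

lemma length_insert_row [simp]: "length (insert_row X As) = Suc (length As)"
  by (induction As arbitrary: X) auto

text \<open>Balls never change column. This confines the rows to \<open>{1..n}\<close> in both
  directions: after an insertion, and when a preimage is constructed.\<close>

lemma Union_insert_row:
  "finite X \<Longrightarrow> \<forall>A\<in>set As. finite A \<Longrightarrow> \<Union>(set (insert_row X As)) = X \<union> \<Union>(set As)"
proof (induction As arbitrary: X)
  case (Cons A As)
  have "finite X" "finite A" using Cons.prems by simp_all
  note ex = excess_props(1,2) [OF this]
  then have "\<Union>(set (insert_row (A \<union> excess X A) As)) = A \<union> excess X A \<union> \<Union>(set As)"
    using Cons.prems by (simp add: Cons.IH)
  then show ?case using ex(1) by auto
qed simp

lemma interlaced_insert_row: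
  "finite X \<Longrightarrow> \<forall>A\<in>set As. finite A \<Longrightarrow> sorted_wrt dominated As \<Longrightarrow>
   interlaced dominated (insert_row X As) As"
proof (induction As arbitrary: X)
  case (Cons A As)
  have fin: "finite X" "finite A" using Cons.prems by auto
  note ex = excess_props [OF fin]
  have IH: "interlaced dominated (insert_row (A \<union> excess X A) As) As"
    by (rule Cons.IH) (use Cons.prems ex(2) in simp_all)
  show ?case
  proof (cases As)
    case Nil
    have "dominated A (A \<union> excess X A)"
      using cnt_mono [of "A \<union> excess X A" A] fin ex(2) by (simp add: dominated_def)
    then show ?thesis using Nil ex(6) by simp
  next
    case (Cons A' As')
    have "dominated A (A \<union> excess X A - excess (A \<union> excess X A) A')"
      by (rule dominated_Un_excess) (use Cons.prems Cons ex(2,3) fin in auto)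
    then show ?thesis using Cons IH ex(6) by simp
  qed
qed simp

lemma interlaced_sorted:
  "interlaced le Ds As \<Longrightarrow> transp le \<Longrightarrow> sorted_wrt le Ds"
proof (induction le Ds As rule: interlaced.induct)
  case (2 le d e ds a as)
  then have "le d e" "sorted_wrt le (e # ds)" by (auto dest: transpD)
  then show ?case using 2(3) by (auto dest: transpD)
qed auto

lemma transp_dominated: "transp dominated"
  using dominated_trans by (rule transpI)

lemma sorted_insert_row:
  "finite X \<Longrightarrow> \<forall>A\<in>set As. finite A \<Longrightarrow> sorted_wrt dominated As \<Longrightarrow>
   sorted_wrt dominated (insert_row X As)"
  using interlaced_insert_row interlaced_sorted transp_dominated by blast

lemma interlaced_map:
  "interlaced le Ds As \<Longrightarrow> (\<And>x y. le x y \<Longrightarrow> le' (f x) (f y)) \<Longrightarrow> interlaced le' (map f Ds) (map f As)"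
  by (induction le Ds As rule: interlaced.induct) auto

lemma weight_insert_row:
  "finite X \<Longrightarrow> \<forall>A\<in>set As. finite A \<Longrightarrow> weight x (insert_row X As) = weight x (X # As)"
proof (induction As arbitrary: X)
  case (Cons A As)
  have fin: "finite X" "finite A" using Cons.prems by auto
  note ex = excess_props [OF fin]
  have "weight x (insert_row X (A # As)) = prod x (X - excess X A) * (prod x (A \<union> excess X A) * weight x As)"
    using Cons.IH [of "A \<union> excess X A"] Cons.prems ex(2) by (simp add: weight_def)
  \<comment> \<open>Since the moved balls avoid \<open>A\<close>, their factor splits off the lower
    row and returns to \<open>X\<close>.\<close>
  also have "\<dots> = (prod x (X - excess X A) * prod x (excess X A)) * (prod x A * weight x As)"
    using ex(2,3) fin by (subst prod.union_disjoint) (auto simp: ac_simps)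
  also have "prod x (X - excess X A) * prod x (excess X A) = prod x X"
    using ex(1) fin by (simp add: prod.subset_diff [of "excess X A" X])
  finally show ?case by (simp add: weight_def)
qed (simp add: weight_def)

section \<open>Inverting a row insertion\<close>

text \<open>Undoing an exchange returns to the upper row \<open>D\<close> the rightmost balls of the lower row \<open>E\<close>
  that are not matched; of all sets \<open>V\<close> that stay below the slack \<open>cnt E - cnt D\<close> this one has the
  largest counts, which determines it by its size.\<close>

lemma cnt_le_undo:
  assumes fin: "finite D" "finite E" "finite U" "finite V"
    and U: "U \<subseteq> E" "U \<inter> D = {}" "\<forall>j\<in>U. cnt D j + cnt U j = cnt E j"
    and V: "\<forall>j. cnt D j + cnt V j \<le> cnt E j"
    and "card V \<le> card U"
  shows "cnt V j \<le> cnt U j"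
proof (induction j)
  case 0
  then show ?case using assms by simp
next
  case (Suc j)
  show ?case
  proof (cases "j \<in> U")
    case False
    then show ?thesis using Suc cnt_Suc [OF fin(3), of j] cnt_antimono [OF fin(4), of j "Suc j"] by simp
  next
    \<comment> \<open>Equality persists in column \<open>Suc j\<close>: \<open>E\<close> and
      \<open>U\<close> both lose the ball \<open>j\<close> while \<open>D\<close> is unaffected. So
      \<open>cnt U (Suc j)\<close> is the whole slack there, which bounds
      \<open>cnt V\<close>.\<close>
    case True
    then have "j \<in> E" "j \<notin> D" "cnt D j + cnt U j = cnt E j" using U by auto
    moreover have "cnt D (Suc j) + cnt V (Suc j) \<le> cnt E (Suc j)" using V by blast
    ultimately show ?thesis
      using True cnt_Suc [OF fin(1), of j] cnt_Suc [OF fin(2), of j] cnt_Suc [OF fin(3), of j] by simp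
  qed
qed

text \<open>Adding \<open>cnt U\<close> back to \<open>C - U\<close> and splitting it off
  \<open>A \<union> U\<close> turns the excess conditions into conditions on the output rows, the
  form that \<open>cnt_le_undo\<close> expects.\<close>

lemma is_excess_undo:
  assumes "finite C" "finite A" "is_excess C A U"
  shows "U \<subseteq> A \<union> U" "U \<inter> (C - U) = {}"
    "cnt (C - U) j + cnt U j \<le> cnt (A \<union> U) j"
    "j \<in> U \<Longrightarrow> cnt (C - U) j + cnt U j = cnt (A \<union> U) j"
proof -
  have "A \<inter> U = {}" using is_excess_disjoint [OF assms] by blast
  then have "cnt (A \<union> U) j = cnt A j + cnt U j" "cnt (C - U) j + cnt U j = cnt C j"
    using assms is_excess_finite [OF assms(1,3)] by (auto simp: cnt_Un cnt_Diff is_excess_def)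
  then show "cnt (C - U) j + cnt U j \<le> cnt (A \<union> U) j"
    "j \<in> U \<Longrightarrow> cnt (C - U) j + cnt U j = cnt (A \<union> U) j"
    using assms(3) by (auto simp: is_excess_def)
qed auto

text \<open>Given the output, \<open>card A\<close> fixes the number of moved balls;
  \<open>cnt_le_undo\<close>, applied both ways, then fixes the balls.\<close>

lemma excess_inj:
  assumes fin: "finite C" "finite A" "finite C'" "finite A'"
    and eq: "C - excess C A = C' - excess C' A'" "A \<union> excess C A = A' \<union> excess C' A'"
    and card: "card A = card A'"
  shows "C = C' \<and> A = A'"
proof -
  define U U' where "U = excess C A" and "U' = excess C' A'"
  note d = U_def [symmetric] U'_def [symmetric]
  have U: "is_excess C A U" "finite U" "U \<subseteq> C" "U \<inter> A = {}"
    and U': "is_excess C' A' U'" "finite U'" "U' \<subseteq> C'" "U' \<inter> A' = {}"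
    unfolding U_def U'_def
    by (intro is_excess_excess excess_props fin)+
  have "card (A \<union> U) = card A + card U" "card (A' \<union> U') = card A' + card U'"
    using U U' fin by (auto intro!: card_Un_disjoint)
  then have cardU: "card U = card U'" using eq card unfolding d by simp
  have eqs: "C - U = C' - U'" "A \<union> U = A' \<union> U'" using eq unfolding d .
  note u = is_excess_undo [OF fin(1,2) U(1)] and u' = is_excess_undo [OF fin(3,4) U'(1)]
  have "cnt U j \<le> cnt U' j" for j
    by (rule cnt_le_undo [of "C - U" "A \<union> U"]) (use u u' eqs U U' fin cardU in auto)
  moreover have "cnt U' j \<le> cnt U j" for j
    by (rule cnt_le_undo [of "C' - U'" "A' \<union> U'"]) (use u u' eqs U U' fin cardU in auto)
  ultimately have "U = U'" using U U' by (intro cnt_eqI) (auto intro: le_antisym)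
  then show ?thesis using eqs U U' by blast
qed

text \<open>The induction first recovers the carried row \<open>A \<union> excess X A\<close> from
  the tail, hence \<open>X\<close> is arbitrary; only then can the top exchange be undone.\<close>

lemma insert_row_inj:
  "insert_row X As = insert_row X' As' \<Longrightarrow> map card As = map card As' \<Longrightarrow>
   finite X \<Longrightarrow> finite X' \<Longrightarrow> \<forall>A\<in>set As. finite A \<Longrightarrow> \<forall>A\<in>set As'. finite A \<Longrightarrow> X = X' \<and> As = As'"
proof (induction As arbitrary: X X' As')
  case Nil
  then show ?case by simp
next
  case (Cons A As)
  then obtain A' As'' where As': "As' = A' # As''" by (cases As') auto
  have fin: "finite X" "finite A" "finite X'" "finite A'" using Cons As' by auto
  have "A \<union> excess X A = A' \<union> excess X' A' \<and> As = As''"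
    by (rule Cons.IH) (use Cons.prems As' fin excess_props(2) in simp_all)
  moreover have "X = X' \<and> A = A'"
    by (rule excess_inj) (use Cons.prems As' fin calculation in simp_all)
  ultimately show ?case by (simp add: As')
qed

lemma undo_exists:
  assumes fin: "finite D" "finite E" and dom: "dominated D E" and u: "u + card D \<le> card E"
  shows "\<exists>U. U \<subseteq> E \<and> U \<inter> D = {} \<and> card U = u \<and>
     (\<forall>j. cnt D j + cnt U j \<le> cnt E j) \<and> (\<forall>j\<in>U. cnt D j + cnt U j = cnt E j)"
proof -
  define d where "d = (\<lambda>j. cnt E j - cnt D j)"
  \<comment> \<open>\<open>g\<close> is the running minimum, from the left, of the slack
    \<open>d\<close> capped at \<open>u\<close>, and \<open>U\<close> will be the set of columns
    where it drops. The slack falls by at most one per column, so a drop is by one, at a ball of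
    \<open>E\<close> outside \<open>D\<close>, starting from \<open>g j = d j\<close>.\<close>
  define g where "g = rec_nat u (\<lambda>j g. min g (d (Suc j)))"
  have g: "g 0 = u" "\<And>j. g (Suc j) = min (g j) (d (Suc j))" by (simp_all add: g_def)
  have d: "cnt D j + d j = cnt E j" for j using dom by (simp add: d_def dominated_def)
  have gd: "g j \<le> d j" for j using u d [of 0] by (cases j) (auto simp: g)
  define U where "U = {j. g (Suc j) < g j}"
  have step: "j \<in> E \<and> j \<notin> D \<and> g j = d j \<and> g j = Suc (g (Suc j))" if "j \<in> U" for j
    using that gd [of j] d [of j] d [of "Suc j"] cnt_Suc [OF fin(1), of j] cnt_Suc [OF fin(2), of j]
    by (auto simp: U_def g split: if_splits)
  have nostep: "g (Suc j) = g j" if "j \<notin> U" for j using that by (auto simp: U_def g)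
  have "U \<subseteq> E" using step by blast
  then have finU: "finite U" using fin(2) finite_subset by blast
  \<comment> \<open>To the right of all balls of \<open>E\<close> the slack vanishes, and with it
    \<open>g\<close> and \<open>cnt U\<close>; this anchors a downward induction.\<close>
  define N where "N = Suc (Max (insert 0 E))"
  have "x < N" if "x \<in> E" for x using that fin(2) by (simp add: N_def less_Suc_eq_le)
  then have EN: "E \<inter> {j..} = {}" if "N \<le> j" for j using that by fastforce
  have cU: "cnt U j = g j" for j
  proof (cases "N \<le> j")
    case True
    have "cnt E j = 0" using EN [OF True] by (simp add: cnt_def)
    moreover have "cnt U j \<le> cnt E j" using \<open>U \<subseteq> E\<close> fin cnt_mono by blast
    ultimately show ?thesis using gd [of j] d [of j] by simp
  next
    case False
    then have "j \<le> N" by simp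
    then show ?thesis
    proof (induction rule: inc_induct)
      case base
      have "cnt E N = 0" using EN [of N] by (simp add: cnt_def)
      moreover have "cnt U N \<le> cnt E N" using \<open>U \<subseteq> E\<close> fin cnt_mono by blast
      ultimately show ?case using gd [of N] d [of N] by simp
    next
      case (step k)
      then show ?case using cnt_Suc [OF finU, of k] \<open>k \<in> U \<Longrightarrow> _\<close> nostep [of k] by auto
    qed
  qed
  show ?thesis
  proof (intro exI [of _ U] conjI)
    show "card U = u" using cU [of 0] g(1) by simp
    show "\<forall>j. cnt D j + cnt U j \<le> cnt E j" 
    proof
      fix j show "cnt D j + cnt U j \<le> cnt E j" using gd [of j] d [of j] by (simp add: cU)
    qed
    show "\<forall>j\<in>U. cnt D j + cnt U j = cnt E j"
    proof
      fix j assume "j \<in> U" 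
      then show "cnt D j + cnt U j = cnt E j" using step [of j] d [of j] by (simp add: cU)
    qed
  qed (use step in auto)
qed

lemma insert_row_surj:
  "sorted_wrt dominated Ds \<Longrightarrow> \<forall>D\<in>set Ds. finite D \<Longrightarrow> interlaced (\<le>) (map card Ds) as \<Longrightarrow>
   \<exists>X As. insert_row X As = Ds \<and> map card As = as \<and> sorted_wrt dominated As \<and>
     finite X \<and> (\<forall>A\<in>set As. finite A)"
proof (induction as arbitrary: Ds)
  case Nil
  \<comment> \<open>\<open>remdups_adj.cases\<close> serves as the split into no row, one row and at
    least two rows.\<close>
  then obtain D where "Ds = [D]" by (cases Ds rule: remdups_adj.cases) auto
  then show ?case using Nil by (intro exI [of _ D] exI [of _ "[]"]) auto
next
  case (Cons a as)
  then obtain D D' Ds' where Ds: "Ds = D # D' # Ds'" by (cases Ds rule: remdups_adj.cases) auto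
  have a: "card D \<le> a" "a \<le> card D'" using Cons.prems(3) Ds by auto
  obtain Y As where Y: "insert_row Y As = D' # Ds'" "map card As = as" "sorted_wrt dominated As"
     "finite Y" "\<forall>A\<in>set As. finite A"
  proof -
    have "\<exists>Y As. insert_row Y As = D' # Ds' \<and> map card As = as \<and> sorted_wrt dominated As \<and>
      finite Y \<and> (\<forall>A\<in>set As. finite A)"
      by (rule Cons.IH) (use Cons.prems Ds in auto)
    then show ?thesis using that by blast
  qed
  have D': "D' \<subseteq> Y" using Y by (cases As) auto
  have fin: "finite D" "finite D'" and dom: "dominated D D'" using Cons.prems Ds by auto
  have "dominated D Y" using dom cnt_mono [OF Y(4) D'] by (meson dominated_def order_trans)
  \<comment> \<open>\<open>card D \<le> a\<close> is the half of interlacing that makes room for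
    \<open>card Y - a\<close> balls in the slack of \<open>Y\<close> over \<open>D\<close>.\<close>
  moreover have cY: "a \<le> card Y" using card_mono [OF Y(4) D'] a by simp
  ultimately obtain U where U: "U \<subseteq> Y" "U \<inter> D = {}" "card U = card Y - a"
     "\<forall>j. cnt D j + cnt U j \<le> cnt Y j" "\<forall>j\<in>U. cnt D j + cnt U j = cnt Y j"
  proof -
    assume "dominated D Y" "a \<le> card Y"
    then show ?thesis using undo_exists [OF fin(1) Y(4), of "card Y - a"] a(1) that by force
  qed
  have finU: "finite U" using U(1) Y(4) finite_subset by blast
  have cA: "cnt (Y - U) j + cnt U j = cnt Y j" for j using cnt_Diff U(1) Y(4) by blast
  have cX: "cnt (D \<union> U) j = cnt D j + cnt U j" for j using cnt_Un fin(1) finU U(2) by blast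
  have "is_excess (D \<union> U) (Y - U) U" using U(4,5) by (simp add: is_excess_def cA cX)
  then have ex: "excess (D \<union> U) (Y - U) = U" using excess_eqI fin(1) finU by blast
  have chain: "sorted_wrt dominated ((Y - U) # As)"
  proof (cases As)
    case (Cons A' As')
    \<comment> \<open>\<open>V\<close> is a competitor of \<open>U\<close>: it respects the slack
      because \<open>D\<close> is dominated by \<open>Y - V\<close>, and
      \<open>a \<le> card D'\<close> makes it no larger. Hence \<open>cnt V \<le> cnt U\<close>, and
      removing \<open>U\<close> from \<open>Y\<close> restores dominance as well as removing
      \<open>V\<close> does.\<close>
    define V where "V = excess Y A'"
    have finA: "finite A'" using Y(5) Cons by simp
    note V = excess_props [OF Y(4) finA, folded V_def]
    have D'V: "D' = Y - V" using Y(1) Cons V_def by simp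
    have "cnt V j \<le> cnt U j" for j
    proof (rule cnt_le_undo [of D Y])
      show "\<forall>j. cnt D j + cnt V j \<le> cnt Y j"
        using dom cnt_Diff [OF Y(4) V(1)] unfolding dominated_def D'V
        by (metis add_le_mono1)
      have "card Y = card (Y - V) + card V" using cnt_Diff [OF Y(4) V(1), of 0] by simp
      then show "card V \<le> card U" using a cY U(3) unfolding D'V by linarith
    qed (use U V fin finU Y in auto)
    then have "cnt (Y - U) j \<le> cnt A' j" for j
      using cA [of j] V(4) [of j] by (metis add_le_cancel_right add_mono_thms_linordered_semiring(2) order_trans)
    then have "dominated (Y - U) A'" by (simp add: dominated_def)
    then show ?thesis using Y(3) Cons dominated_trans by auto
  qed simp
  have "card (Y - U) = a" using U(1,3) cY finU by (simp add: card_Diff_subset)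
  moreover have "insert_row (D \<union> U) ((Y - U) # As) = Ds"
    using Y(1) U(1,2) ex Ds by (simp add: Un_absorb2 Diff_triv Int_commute Un_Diff)
  ultimately show ?case using chain Y fin finU
    by (intro exI [of _ "D \<union> U"] exI [of _ "(Y - U) # As"]) auto
qed

section \<open>Collapsing as row insertion\<close>

lemma cancel_Cons_cong: "cancel xs = cancel ys \<Longrightarrow> cancel (x # xs) = cancel (x # ys)"
  by (cases x; cases "snd x") auto

lemma cancel_match_step: "cancel (match_step xs) = cancel xs"
proof (induction xs rule: match_step.induct)
  case (1 p q xs)
  show ?case by simp
qed (unfold match_step.simps, (erule cancel_Cons_cong | rule refl)+)

lemma match_step_length: "match_step xs = xs \<or> length (match_step xs) < length xs"
  by (induction xs rule: match_step.induct) auto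

lemma cancel_Cons: "cancel ((p, b) # xs) =
    (if b then case cancel xs of (q, False) # ys \<Rightarrow> ys | ys \<Rightarrow> (p, True) # ys
     else (p, False) # cancel xs)"
  by (cases b) simp_all

lemma match_step_fix: "match_step xs = xs \<Longrightarrow> cancel xs = xs"
proof (induction xs rule: match_step.induct)
  case (1 p q xs)
  then have "length xs = length ((p, True) # (q, False) # xs)" by simp
  then show ?case by simp
qed (auto simp: cancel_Cons)

text \<open>Each effective step shortens the word and preserves \<open>cancel\<close>, and
  \<open>cancel\<close> is the identity on words where no step applies.\<close>

lemma match_step_iterate: "length xs \<le> m \<Longrightarrow> (match_step ^^ m) xs = cancel xs"
proof (induction m arbitrary: xs)
  case (Suc m)
  show ?case
  proof (cases "match_step xs = xs")
    case True
    then have "(match_step ^^ k) xs = xs" for k by (induction k) auto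
    then show ?thesis using True match_step_fix by metis
  next
    case False
    then have "length (match_step xs) \<le> m" using match_step_length [of xs] Suc.prems by linarith
    then show ?thesis
      using Suc.IH [of "match_step xs"] by (simp add: funpow_Suc_right cancel_match_step del: funpow.simps)
  qed
qed simp

lemma cancel_map: "cancel (map (map_prod f id) xs) = map (map_prod f id) (cancel xs)"
  by (induction xs rule: cancel.induct) (auto split: list.splits bool.splits)

text \<open>Cancellation looks only at bracket types, so positions in the word may be renamed to
  columns even though that renaming need not be injective.\<close>

lemma unmatched_columns:
  "map (map_prod (\<lambda>p. snd (cells ! p)) id) (unmatched i (map fst cells)) =
   cancel (map (\<lambda>c. (snd c, fst c = Suc i)) (filter (\<lambda>c. fst c = i \<or> fst c = Suc i) cells))"
proof -
  let ?f = "\<lambda>p. snd (cells ! p)"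
  let ?h = "\<lambda>c :: nat \<times> 'a. if fst c = i \<or> fst c = Suc i then [(snd c, fst c = Suc i)] else []"
  have filt: "map (\<lambda>c. (snd c, fst c = Suc i)) (filter (\<lambda>c. fst c = i \<or> fst c = Suc i) cs) =
    concat (map ?h cs)" for cs by (induction cs) auto
  have "map (map_prod ?f id) (par_word i (map fst cells)) =
      concat (map (\<lambda>p. ?h (cells ! p)) [0..<length cells])"
    unfolding par_word_def by (auto simp: map_concat o_def intro!: arg_cong [of _ _ concat])
  also have "map (\<lambda>p. ?h (cells ! p)) [0..<length cells] = map ?h (map (\<lambda>p. cells ! p) [0..<length cells])"
    by simp
  also have "map (\<lambda>p. cells ! p) [0..<length cells] = cells" by (rule map_nth)
  finally show ?thesis
    unfolding filt unmatched_def Let_def match_step_iterate [OF order_refl] cancel_map [symmetric]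
    by (rule arg_cong)
qed

text \<open>Reading columns downwards puts the ball of row \<open>Suc i\<close> before that of row
  \<open>i\<close>, the order built into \<open>col_word\<close>.\<close>

lemma cw_cells_rows:
  assumes "1 \<le> i" "i < length B"
  shows "map (\<lambda>c. (snd c, fst c = Suc i)) (filter (\<lambda>c. fst c = i \<or> fst c = Suc i) (cw_cells n B)) =
   concat (map (col_word (B ! i) (B ! (i - 1))) [1..<Suc n])"
proof -
  let ?g = "\<lambda>cs. map (\<lambda>c. (snd c, fst c = Suc i)) (filter (\<lambda>c. fst c = i \<or> fst c = Suc i) cs)"
  have g_concat: "?g (concat xss) = concat (map ?g xss)" for xss
    by (simp add: filter_concat map_concat o_def)
  have "[1..<length B + 1] = [1..<i] @ [i, Suc i] @ [Suc (Suc i)..<length B + 1]"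
  proof -
    have "[1..<length B + 1] = [1..<i] @ [i..<length B + 1]"
      using assms upt_add_eq_append [of 1 i "length B + 1 - i"] by simp
    then show ?thesis using assms by (simp add: upt_conv_Cons del: upt_Suc)
  qed
  then have rows: "rev [1..<length B + 1] = rev [Suc (Suc i)..<length B + 1] @ [Suc i, i] @ rev [1..<i]"
    by simp
  have col: "?g (concat (map (\<lambda>r. if j \<in> B ! (r - 1) then [(r, j)] else []) (rev [1..<length B + 1]))) =
      col_word (B ! i) (B ! (i - 1)) j" for j
  proof -
    have "?g (concat (map (\<lambda>r. if j \<in> B ! (r - 1) then [(r, j)] else []) rs)) = []"
      if "\<forall>r\<in>set rs. r \<noteq> i \<and> r \<noteq> Suc i" for rs
      using that by (induction rs) auto
    from this [of "rev [Suc (Suc i)..<length B + 1]"] this [of "rev [1..<i]"]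
    show ?thesis unfolding rows by (auto simp: col_word_def)
  qed
  show ?thesis
    unfolding cw_cells_def by (subst g_concat) (simp only: map_map o_def col Suc_eq_plus1 [of n])
qed

lemma estar_eq:
  assumes "1 \<le> i" "i < length B" "\<forall>S\<in>set B. S \<subseteq> {1..n}"
  shows "estar n i B = B[i - 1 := B ! (i - 1) \<union> excess (B ! i) (B ! (i - 1)),
                         i := B ! i - excess (B ! i) (B ! (i - 1))]"
proof -
  define cells where "cells = cw_cells n B"
  let ?C = "B ! i" and ?A = "B ! (i - 1)"
  have sub: "?C \<subseteq> {1..n}" "?A \<subseteq> {1..n}" using assms by auto
  have sub0: "?C \<subseteq> {..n}" "?A \<subseteq> {..n}" "finite ?C"
    using sub by (auto simp: finite_subset [OF _ finite_atLeastAtMost])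
  \<comment> \<open>Columns start at 1, whereas \<open>is_excess_cancel\<close> scans from 0; the
    additional column is empty.\<close>
  have "0 \<notin> ?C" "0 \<notin> ?A" using sub by auto
  then have "concat (map (col_word ?C ?A) [0..<Suc n]) = concat (map (col_word ?C ?A) [1..<Suc n])"
    by (simp add: upt_conv_Cons [of 0] col_word_def del: upt_Suc)
  then have ex: "{j. (j, True) \<in> set (cancel (concat (map (col_word ?C ?A) [1..<Suc n])))} = excess ?C ?A"
    using excess_eqI [OF sub0(3) is_excess_cancel [OF sub0(1,2)]] by simp
  have "{snd (cells ! p) | p. (p, True) \<in> set (unmatched i (map fst cells))} =
     {j. (j, True) \<in> set (map (map_prod (\<lambda>p. snd (cells ! p)) id) (unmatched i (map fst cells)))}"
    by force
  also have "\<dots> = excess ?C ?A"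
    unfolding unmatched_columns unfolding cells_def cw_cells_rows [OF assms(1,2)] by (rule ex)
  finally show ?thesis by (simp add: estar_def Let_def cells_def)
qed

text \<open>With \<open>foldr\<close> the highest index acts first, so the exchanges run downwards
  from \<open>X\<close>. Each of them adds a finished row to \<open>R\<close>, which must therefore
  be arbitrary.\<close>

lemma foldr_estar_insert_row:
  "\<forall>S\<in>set (X # As @ R). S \<subseteq> {1..n} \<Longrightarrow>
   foldr (estar n) [1..<length As + 1] (rev As @ X # R) = rev (insert_row X As) @ R"
proof (induction As arbitrary: X R)
  case (Cons A As)
  let ?m = "Suc (length As)" and ?U = "excess X A"
  have fin: "finite X" "finite A" using Cons.prems by (auto simp: finite_subset [OF _ finite_atLeastAtMost])
  have "estar n ?m (rev As @ A # X # R) = rev As @ (A \<union> ?U) # (X - ?U) # R"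
    using Cons.prems by (subst estar_eq) (auto simp: nth_append list_update_append)
  moreover have "foldr (estar n) [1..<length As + 1] (rev As @ (A \<union> ?U) # (X - ?U) # R) =
      rev (insert_row (A \<union> ?U) As) @ (X - ?U) # R"
    using Cons.prems excess_props(1) [OF fin] by (intro Cons.IH) auto
  ultimately show ?case by simp
qed simp

abbreviation insert_rows :: "nat set list \<Rightarrow> nat set list" where
  "insert_rows B \<equiv> fold insert_row B []"

lemma insert_rows_sub:
  "\<forall>S\<in>set B. S \<subseteq> {1..n} \<Longrightarrow> \<forall>S\<in>set (insert_rows B). S \<subseteq> {1..n}"
proof (induction B rule: rev_induct)
  case (snoc X B)
  then have IH: "\<forall>S\<in>set (insert_rows B). S \<subseteq> {1..n}" and X: "X \<subseteq> {1..n}" by auto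
  then have "\<forall>S\<in>set (insert_rows B). finite S" "finite X"
    using finite_subset [OF _ finite_atLeastAtMost] by blast+
  then have "\<Union>(set (insert_rows (B @ [X]))) = X \<union> \<Union>(set (insert_rows B))"
    using Union_insert_row by simp
  then show ?case using IH X by blast
qed simp

lemma length_insert_rows [simp]: "length (insert_rows B) = length B"
  by (induction B rule: rev_induct) auto

lemma collapse_upto_eq:
  assumes "\<forall>S\<in>set B. S \<subseteq> {1..n}"
  shows "k \<le> length B \<Longrightarrow> collapse_upto n k B = rev (insert_rows (take k B)) @ drop k B"
proof (induction k)
  case 0
  then show ?case by (simp add: collapse_upto_def)
next
  case (Suc k)
  let ?S = "insert_rows (take k B)"
  have d: "drop k B = B ! k # drop (Suc k) B" "take (Suc k) B = take k B @ [B ! k]"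
    using Suc.prems by (simp_all add: Cons_nth_drop_Suc take_Suc_conv_app_nth)
  show ?case
  proof (cases "k = 0")
    \<comment> \<open>For the first row the fold is empty, and insertion into no rows returns the
      row itself.\<close>
    case True
    then show ?thesis using d by (simp add: collapse_upto_def)
  next
    case False
    have len: "length ?S = k" using Suc.prems by simp
    have sub: "\<forall>S\<in>set (B ! k # ?S @ drop (Suc k) B). S \<subseteq> {1..n}"
      using assms Suc.prems insert_rows_sub [of "take k B" n] by (auto dest: in_set_takeD in_set_dropD)
    have "collapse_upto n (Suc k) B = estar_int n 1 k (collapse_upto n k B)"
      using False by (simp add: collapse_upto_def)
    also have "\<dots> = foldr (estar n) [1..<length ?S + 1] (rev ?S @ B ! k # drop (Suc k) B)"
      using Suc by (simp add: estar_int_def d(1))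
    also have "\<dots> = rev (insert_row (B ! k) ?S) @ drop (Suc k) B"
      by (rule foldr_estar_insert_row) (rule sub)
    finally show ?thesis by (simp add: d(2))
  qed
qed

section \<open>Vanishing of the major index\<close>

text \<open>One pairing of the \<open>maj\<close> computation: \<open>c\<close> and its partner
  \<open>j\<close> are removed together. Stated for an arbitrary ball \<open>c\<close>, it fits
  whatever order the labels dictate.\<close>

lemma dominated_insert_iff:
  assumes fin: "finite C" "finite A" and c: "c \<notin> C" and ex: "\<exists>x\<in>A. c \<le> x"
  defines "j \<equiv> Min {x \<in> A. c \<le> x}"
  shows "dominated (insert c C) A \<longleftrightarrow> dominated C (A - {j})"
proof -
  have "j \<in> {x \<in> A. c \<le> x}" unfolding j_def using fin ex by (intro Min_in) auto
  then have j: "j \<in> A" "c \<le> j" by auto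
  have jmin: "j \<le> x" if "x \<in> A" "c \<le> x" for x
    unfolding j_def using fin that by (intro Min_le) auto
  have single: "cnt {a} t = (if t \<le> a then 1 else 0)" for a t by (simp add: cnt_def)
  have cC: "cnt (insert c C) t = cnt C t + (if t \<le> c then 1 else 0)" for t
    using cnt_Un [OF fin(1), of "{c}" t] c by (simp add: single)
  have cA: "cnt A t = cnt (A - {j}) t + (if t \<le> j then 1 else 0)" for t
    using cnt_Diff [OF fin(2), of "{j}" t] j by (simp add: single)
  show ?thesis
  proof
    assume d: "dominated C (A - {j})"
    show "dominated (insert c C) A"
      unfolding dominated_def
    proof
      fix t
      have "cnt C t \<le> cnt (A - {j}) t" using d by (simp add: dominated_def)
      then show "cnt (insert c C) t \<le> cnt A t" using cC [of t] cA [of t] j(2) by simp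
    qed
  next
    assume d: "dominated (insert c C) A"
    show "dominated C (A - {j})"
      unfolding dominated_def
    proof
      fix t
      have dt: "cnt (insert c C) t \<le> cnt A t" for t using d by (simp add: dominated_def)
      show "cnt C t \<le> cnt (A - {j}) t"
      proof (cases "c < t \<and> t \<le> j")
        \<comment> \<open>\<open>A\<close> has no ball from \<open>c\<close> up to just before
          \<open>j\<close>, so the bound at \<open>t\<close> comes from the one at \<open>c\<close>,
          where the ball \<open>c\<close> itself leaves a unit to spare.\<close>
        case True
        then have "A \<inter> {t..} = A \<inter> {c..}" using jmin by fastforce
        then have "cnt A t = cnt A c" by (simp add: cnt_def)
        moreover have "cnt C t \<le> cnt C c" using True fin(1) cnt_antimono by simp
        ultimately show ?thesis using dt [of c] cC [of c] cA [of t] True by simp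
      next
        case False
        then show ?thesis using dt [of t] cC [of t] cA [of t] j(2) by (auto split: if_splits)
      qed
    qed
  qed
qed

lemma pair_step_eq_0_iff:
  "finite A \<Longrightarrow> distinct (map fst bs) \<Longrightarrow> length bs \<le> card A \<Longrightarrow>
   snd (pair_step r A bs) = 0 \<longleftrightarrow> dominated (fst ` set bs) A"
proof (induction bs arbitrary: A)
  case (Cons b bs)
  obtain c l where b: "b = (c, l)" by force
  show ?case
  proof (cases "\<exists>x\<in>A. c \<le> x")
    case True
    define j where "j = Min {x \<in> A. c \<le> x}"
    have "j \<in> {x \<in> A. c \<le> x}" unfolding j_def using Cons.prems(1) True by (intro Min_in) auto
    then have j: "j \<in> A" "c \<le> j" by auto
    have "snd (pair_step r A (b # bs)) = snd (pair_step r (A - {j}) bs)"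
      using True j by (simp add: b Let_def j_def split: prod.split)
    moreover have "snd (pair_step r (A - {j}) bs) = 0 \<longleftrightarrow> dominated (fst ` set bs) (A - {j})"
      using Cons.prems j(1) by (intro Cons.IH) auto
    moreover have "dominated (insert c (fst ` set bs)) A \<longleftrightarrow> dominated (fst ` set bs) (A - {j})"
      unfolding j_def using Cons.prems True b by (intro dominated_insert_iff) auto
    ultimately show ?thesis by (simp add: b)
  next
    case False
    \<comment> \<open>The length bound keeps \<open>A\<close> nonempty, so \<open>Min A\<close> is a
      genuine partner and the pairing wraps. Its contribution \<open>l - r + 1\<close> is positive
      even with truncated subtraction; correspondingly dominance fails at \<open>c\<close>.\<close>
    have "A \<noteq> {}" using Cons.prems by auto
    then have "Min A < c" using False Min_in [OF Cons.prems(1)] by fastforce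
    then have "snd (pair_step r A (b # bs)) \<noteq> 0"
      using False by (simp add: b Let_def split: prod.split)
    moreover have "A \<inter> {c..} = {}" using False by auto
    then have "cnt A c = 0" by (simp add: cnt_def)
    moreover have "cnt (fst ` set (b # bs)) c > 0" by (auto simp: cnt_def b card_gt_0_iff)
    ultimately show ?thesis unfolding dominated_def by (metis less_le_not_le)
  qed
qed simp

lemma pair_step_labels: "snd ` set (fst (pair_step r A bs)) \<subseteq> snd ` set bs"
proof (induction bs arbitrary: A)
  case (Cons b bs)
  obtain c l where b: "b = (c, l)" by force
  have "\<exists>j. fst (pair_step r A (b # bs)) = (j, l) # fst (pair_step r (A - {j}) bs)"
    unfolding b pair_step.simps Let_def by (simp split: prod.split)
  then obtain j where "fst (pair_step r A (b # bs)) = (j, l) # fst (pair_step r (A - {j}) bs)" ..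
  then show ?case using Cons [of "A - {j}"] by (auto simp: b)
qed simp

lemma distinct_fst_by_label:
  assumes "distinct xs" "distinct ls"
  shows "distinct (map fst (concat (map (\<lambda>l. [(c, l). c \<leftarrow> xs, lab c = l]) ls)))"
  using assms(2)
proof (induction ls)
  case (Cons l ls)
  have "map fst [(c, l). c \<leftarrow> ys, lab c = l] = filter (\<lambda>c. lab c = l) ys" for ys
    by (induction ys) auto
  then have "map fst (concat (map (\<lambda>l. [(c, l). c \<leftarrow> xs, lab c = l]) (l # ls))) =
     filter (\<lambda>c. lab c = l) xs @ map fst (concat (map (\<lambda>l. [(c, l). c \<leftarrow> xs, lab c = l]) ls))"
    by simp
  then show ?case using Cons assms(1) by auto
qed simp

text \<open>The range condition on \<open>asg\<close> is the invariant of the descent: inherited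
  labels are never below the current row, so listing balls by label from that row upwards misses
  none. Decreasing sizes give every ball a partner.\<close>

lemma maj_aux_eq_0_iff:
  assumes fin: "\<forall>S\<in>set M. finite S" and dec: "\<And>i. Suc i < length M \<Longrightarrow> card (M ! Suc i) \<le> card (M ! i)"
  shows "k \<le> length M \<Longrightarrow> ran asg \<subseteq> {k..length M} \<Longrightarrow>
    maj_aux M k asg = 0 \<longleftrightarrow> (\<forall>i. Suc i < k \<longrightarrow> dominated (M ! Suc i) (M ! i))"
proof (induction k arbitrary: asg)
  case (Suc k')
  show ?case
  proof (cases k')
    case 0
    then show ?thesis by simp
  next
    case (Suc k)
    define r where "r = Suc (Suc k)"
    define lab where "lab = (\<lambda>c. case asg c of Some l \<Rightarrow> l | None \<Rightarrow> r)"
    define balls where "balls = concat (map (\<lambda>l. [(c, l). c \<leftarrow> sorted_list_of_set (M ! (r - 1)), lab c = l])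
                               (rev [r..<length M + 1]))"
    have r: "r \<le> length M" "r - 1 = Suc k" "r - 2 = k" using Suc Suc.prems(1) by (auto simp: r_def)
    have finr: "finite (M ! Suc k)" "finite (M ! k)" using fin r by (auto simp: r_def)
    have lab: "lab c \<in> {r..length M}" for c
    proof (cases "asg c")
      case (Some l)
      then have "l \<in> ran asg" by (rule ranI)
      then show ?thesis using Suc.prems(2) Some Suc by (auto simp: lab_def r_def)
    qed (use r in \<open>simp add: lab_def\<close>)
    have sb: "set balls = {(c, lab c) | c. c \<in> M ! Suc k}"
    proof -
      have "set balls = (\<Union>l\<in>{r..<length M + 1}. \<Union>c\<in>M ! Suc k. if lab c = l then {(c, l)} else {})"
        unfolding balls_def r(2) using finr(1) by (simp add: if_distrib [of set] del: upt_Suc cong: if_cong)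
      then show ?thesis using lab by (auto simp: less_Suc_eq_le split: if_splits)
    qed
    have dist: "distinct (map fst balls)"
      unfolding balls_def by (rule distinct_fst_by_label) auto
    have fsb: "fst ` set balls = M ! Suc k" unfolding sb by force
    have "length balls = card (M ! Suc k)"
      using distinct_card [OF dist] fsb by simp
    then have "snd (pair_step r (M ! k) balls) = 0 \<longleftrightarrow> dominated (M ! Suc k) (M ! k)"
      using pair_step_eq_0_iff [OF finr(2) dist, of r] dec [of k] r fsb by (simp add: r_def)
    moreover have "maj_aux M (Suc k') asg = snd (pair_step r (M ! k) balls) +
        maj_aux M k' (map_of (fst (pair_step r (M ! k) balls)))"
      unfolding Suc maj_aux.simps Let_def
      unfolding r_def [symmetric]
      unfolding balls_def [unfolded lab_def, symmetric] r(3)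
      by (simp split: prod.split)
    moreover have "maj_aux M k' (map_of (fst (pair_step r (M ! k) balls))) = 0 \<longleftrightarrow>
        (\<forall>i. Suc i < k' \<longrightarrow> dominated (M ! Suc i) (M ! i))"
    proof (rule Suc.IH)
      have "ran (map_of ps) \<subseteq> snd ` set ps" for ps :: "(nat \<times> nat) list"
        by (auto simp: ran_def dest!: map_of_SomeD) force
      then have "ran (map_of (fst (pair_step r (M ! k) balls))) \<subseteq> snd ` set balls"
        using pair_step_labels by fastforce
      also have "\<dots> \<subseteq> {r..length M}" unfolding sb using lab by auto
      finally show "ran (map_of (fst (pair_step r (M ! k) balls))) \<subseteq> {k'..length M}"
        using Suc by (auto simp: r_def)
    qed (use Suc.prems in simp)
    ultimately show ?thesis by (auto simp: Suc less_Suc_eq)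
  qed
qed simp

lemma maj_eq_0_iff:
  assumes "\<forall>S\<in>set M. finite S" and "\<And>i. Suc i < length M \<Longrightarrow> card (M ! Suc i) \<le> card (M ! i)"
  shows "maj M = 0 \<longleftrightarrow> (\<forall>i. Suc i < length M \<longrightarrow> dominated (M ! Suc i) (M ! i))"
  unfolding maj_def by (rule maj_aux_eq_0_iff) (use assms in auto)

section \<open>Conjugate partitions and the codomain\<close>

text \<open>Both sides express membership of one cell in the diagram, read by columns or by rows;
  involutivity of conjugation follows.\<close>

lemma less_length_filter_iff:
  "sorted_wrt (\<ge>) nu \<Longrightarrow> i < length nu \<Longrightarrow> i < length (filter (\<lambda>p. j \<le> p) nu) \<longleftrightarrow> j \<le> (nu ! i :: nat)"
proof (induction nu arbitrary: i)
  case (Cons a nu)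
  show ?case
  proof (cases "j \<le> a")
    case True
    then show ?thesis using Cons by (cases i) auto
  next
    case False
    then have "\<forall>p\<in>set (a # nu). \<not> j \<le> p" using Cons.prems(1) by auto
    moreover from this have "filter (\<lambda>p. j \<le> p) (a # nu) = []" by (simp only: filter_empty_conv)
    ultimately show ?thesis using nth_mem [OF Cons.prems(2)] by (metis list.size(3) not_less0)
  qed
qed simp

lemma length_conj_part [simp]: "length (conj_part mu) = first_part mu"
  by (simp add: conj_part_def)

lemma nth_conj_part:
  "j < first_part mu \<Longrightarrow> conj_part mu ! j = length (filter (\<lambda>p. Suc j \<le> p) mu)"
  by (simp add: conj_part_def del: upt_Suc)

lemma is_partition_conj_part: "is_partition (conj_part mu)"
proof -
  have "conj_part mu ! j \<le> conj_part mu ! i" if "i < j" "j < first_part mu" for i j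
  proof -
    have "length (filter (\<lambda>p. Suc j \<le> p) mu) \<le> length (filter (\<lambda>p. Suc i \<le> p) mu)"
      using that(1) by (induction mu) auto
    then show ?thesis using that by (simp add: nth_conj_part)
  qed
  moreover have "conj_part mu ! j \<noteq> 0" if "j < first_part mu" for j
    using that by (cases mu) (auto simp: nth_conj_part first_part_def)
  ultimately show ?thesis
    by (auto simp: is_partition_def sorted_wrt_iff_nth_less in_set_conv_nth)
qed

lemma length_filter_le_upt: "length (filter (\<lambda>j. j \<le> a) [1..<Suc b]) = min a b"
  by (induction b) auto

lemma first_part_ge: "sorted_wrt (\<ge>) nu \<Longrightarrow> p \<in> set nu \<Longrightarrow> p \<le> first_part nu"
  by (cases nu) (auto simp: first_part_def)

lemma first_part_conj_part:
  assumes "is_partition nu" shows "first_part (conj_part nu) = length nu"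
proof (cases nu)
  case Nil
  then show ?thesis by (simp add: conj_part_def first_part_def)
next
  case (Cons a nu')
  then have "first_part nu > 0" using assms by (auto simp: first_part_def is_partition_def)
  then have "first_part (conj_part nu) = conj_part nu ! 0"
    by (cases "conj_part nu") (auto simp: first_part_def dest: arg_cong [of _ _ length])
  also have "\<dots> = length (filter (\<lambda>p. Suc 0 \<le> p) nu)"
    using \<open>first_part nu > 0\<close> by (rule nth_conj_part)
  also have "filter (\<lambda>p. Suc 0 \<le> p) nu = nu"
    using assms by (intro filter_True) (auto simp: is_partition_def Suc_le_eq intro: gr0I)
  finally show ?thesis .
qed

lemma conj_part_conj_part:
  assumes "is_partition nu" shows "conj_part (conj_part nu) = nu"
proof (rule nth_equalityI)
  show len: "length (conj_part (conj_part nu)) = length nu"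
    using first_part_conj_part [OF assms] by simp
  fix i assume "i < length (conj_part (conj_part nu))"
  then have i: "i < length nu" using len by simp
  have dec: "sorted_wrt (\<ge>) nu" using assms by (simp add: is_partition_def)
  have "conj_part (conj_part nu) ! i = length (filter (\<lambda>p. Suc i \<le> p) (conj_part nu))"
    using i first_part_conj_part [OF assms] by (intro nth_conj_part) simp
  also have "\<dots> = length (filter (\<lambda>j. i < length (filter (\<lambda>p. j \<le> p) nu)) [1..<Suc (first_part nu)])"
    by (simp add: conj_part_def filter_map o_def Suc_le_eq del: upt_Suc)
  also have "\<dots> = length (filter (\<lambda>j. j \<le> nu ! i) [1..<Suc (first_part nu)])"
    using less_length_filter_iff [OF dec i] by simp
  also have "\<dots> = nu ! i"
    unfolding length_filter_le_upt using first_part_ge [OF dec nth_mem [OF i]] by simp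
  finally show "conj_part (conj_part nu) ! i = nu ! i" .
qed

lemma sorted_rev_dominated_iff:
  "sorted_wrt dominated (rev M) \<longleftrightarrow> (\<forall>i. Suc i < length M \<longrightarrow> dominated (M ! Suc i) (M ! i))"
  unfolding sorted_wrt_rev
  by (rule sorted_wrt_iff_nth_Suc_transp) (auto intro: transpI dominated_trans)

text \<open>The row sizes of \<open>M\<close> form the conjugate of \<open>mu\<close> and so
  determine \<open>mu\<close>; the union disappears and the tableau has shape
  \<open>map card M\<close>.\<close>

lemma rho_codomain_eq:
  "rho_codomain L n = {(M, T). (\<forall>S\<in>set M. S \<subseteq> {1..n} \<and> S \<noteq> {}) \<and> sorted_wrt dominated (rev M) \<and>
     T \<in> SSYT (map card M) L}" (is "_ = ?R")
proof (intro set_eqI iffI)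
  fix z assume "z \<in> rho_codomain L n"
  then obtain mu M T where z: "z = (M, T)" and mu: "is_partition mu" "M \<in> MLQ mu n" "maj M = 0"
      "T \<in> SSYT (conj_part mu) L"
    by (auto simp: rho_codomain_def MLQ0_def)
  have M: "length M = first_part mu" "\<forall>j < length M. M ! j \<subseteq> {1..n} \<and> card (M ! j) = conj_part mu ! j"
    using mu(2) by (auto simp: MLQ_def split: if_splits)
  have cards: "map card M = conj_part mu" using M by (intro nth_equalityI) auto
  have part: "is_partition (map card M)" unfolding cards by (rule is_partition_conj_part)
  have sub: "\<forall>S\<in>set M. S \<subseteq> {1..n}" using M(2) by (metis in_set_conv_nth)
  have ne: "\<forall>S\<in>set M. S \<noteq> {}" using part by (auto simp: is_partition_def image_iff)
  have "maj M = 0 \<longleftrightarrow> (\<forall>i. Suc i < length M \<longrightarrow> dominated (M ! Suc i) (M ! i))"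
  proof (rule maj_eq_0_iff)
    show "\<forall>S\<in>set M. finite S" using sub finite_subset [OF _ finite_atLeastAtMost] by blast
    fix i assume "Suc i < length M"
    then show "card (M ! Suc i) \<le> card (M ! i)"
      using part sorted_wrt_nth_less [of "(\<ge>)" "map card M" i "Suc i"] by (simp add: is_partition_def)
  qed
  then show "z \<in> ?R" using z mu sub ne by (simp add: sorted_rev_dominated_iff cards)
next
  fix z assume "z \<in> ?R"
  then obtain M T where z: "z = (M, T)" and M: "\<forall>S\<in>set M. S \<subseteq> {1..n} \<and> S \<noteq> {}"
      "sorted_wrt dominated (rev M)" and T: "T \<in> SSYT (map card M) L"
    by auto
  define nu where "nu = map card M"
  have fin: "\<forall>S\<in>set M. finite S" using M(1) by (meson finite_atLeastAtMost finite_subset)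
  have dom: "\<forall>i. Suc i < length M \<longrightarrow> dominated (M ! Suc i) (M ! i)"
    using M(2) by (simp add: sorted_rev_dominated_iff)
  have "sorted_wrt (\<lambda>x y. dominated y x) M" using M(2) by (simp add: sorted_wrt_rev)
  then have "sorted_wrt (\<ge>) nu"
    unfolding nu_def sorted_wrt_map by (rule sorted_wrt_mono_rel [rotated]) (rule dominated_card)
  moreover have "0 \<notin> set nu" using M(1) fin by (auto simp: nu_def)
  ultimately have nu: "is_partition nu" by (simp add: is_partition_def)
  \<comment> \<open>This is the condition \<open>length mu \<le> n\<close> of \<open>MLQ\<close>:
    the conjugate of \<open>nu\<close> has as many parts as row 1 has balls.\<close>
  have "first_part nu \<le> n"
  proof (cases M)
    case (Cons S M')
    then have "card S \<le> card {1..n}" using M(1) by (intro card_mono) auto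
    then show ?thesis using Cons by (simp add: nu_def first_part_def)
  qed (simp add: nu_def first_part_def)
  then have "M \<in> MLQ (conj_part nu) n"
    using first_part_conj_part [OF nu] conj_part_conj_part [OF nu] M(1) by (simp add: MLQ_def nu_def)
  moreover have "maj M = 0 \<longleftrightarrow> (\<forall>i. Suc i < length M \<longrightarrow> dominated (M ! Suc i) (M ! i))"
    using fin dom dominated_card by (intro maj_eq_0_iff) auto
  ultimately have "M \<in> MLQ0 (conj_part nu) n" using dom by (simp add: MLQ0_def)
  then show "z \<in> rho_codomain L n"
    unfolding rho_codomain_def z
    using T conj_part_conj_part [OF nu] is_partition_conj_part [of nu] by (auto simp: nu_def)
qed

section \<open>Padding with empty rows and stripping them\<close>

definition strip :: "'a \<Rightarrow> 'a list \<Rightarrow> 'a list" where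
  "strip e xs = rev (dropWhile (\<lambda>x. x = e) (rev xs))"

lemma strip_snoc: "strip e (xs @ [x]) = (if x = e then strip e xs else xs @ [x])"
  by (simp add: strip_def)

lemma strip_Nil [simp]: "strip e [] = []"
  by (simp add: strip_def)

lemma strip_eq_snocD: "strip e xs = ys @ [x] \<Longrightarrow> x \<noteq> e"
  by (induction xs rule: rev_induct) (auto simp: strip_snoc split: if_splits)

lemma strip_replicate: "e \<notin> set xs \<Longrightarrow> strip e (xs @ replicate k e) = xs"
proof (induction k)
  case 0
  then show ?case by (cases xs rule: rev_cases) (auto simp: strip_def)
next
  case (Suc k)
  then show ?case
    using strip_snoc [of e "xs @ replicate k e" e] by (simp add: replicate_append_same [symmetric])
qed

lemma length_strip: "length (strip e xs) \<le> length xs"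
  using length_dropWhile_le [of "\<lambda>x. x = e" "rev xs"] by (simp add: strip_def)

lemma strip_pad: "strip e xs @ replicate (length xs - length (strip e xs)) e = xs"
proof (induction xs rule: rev_induct)
  case (snoc x xs)
  then show ?case using length_strip [of e xs]
    by (auto simp: strip_snoc Suc_diff_le replicate_append_same [symmetric])
qed (simp add: strip_def)

lemma map_strip: "\<forall>x\<in>set xs. f x = e' \<longleftrightarrow> x = e \<Longrightarrow> map f (strip e xs) = strip e' (map f xs)"
  by (induction xs rule: rev_induct) (auto simp: strip_snoc strip_def)

lemma SSYT_append_Nil:
  "T @ replicate k [] \<in> SSYT (map f M @ replicate k 0) L \<longleftrightarrow> T \<in> SSYT (map f M) L" if "length T = length M"
proof -
  have "(\<forall>r c. Suc r < length (T @ replicate k []) \<and> c < length ((T @ replicate k []) ! Suc r) \<longrightarrow>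
           (T @ replicate k []) ! r ! c < (T @ replicate k []) ! Suc r ! c) \<longleftrightarrow>
        (\<forall>r c. Suc r < length T \<and> c < length (T ! Suc r) \<longrightarrow> T ! r ! c < T ! Suc r ! c)"
    (is "(\<forall>r c. ?P r c) \<longleftrightarrow> (\<forall>r c. ?Q r c)")
  proof (intro iff_allI)
    fix r c show "?P r c \<longleftrightarrow> ?Q r c" by (auto simp: nth_append)
  qed
  then show ?thesis using that by (auto simp: SSYT_def)
qed

text \<open>Going up a column gains at least one per row. Hence at most \<open>L\<close> rows are
  nonempty, and entries up to \<open>k\<close> occur only in the lowest \<open>k\<close>
  rows.\<close>

lemma SSYT_entry_ge:
  assumes T: "T \<in> SSYT nu L" and dec: "\<And>r. Suc r < length nu \<Longrightarrow> nu ! Suc r \<le> nu ! r"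
  shows "r < length T \<Longrightarrow> c < length (T ! r) \<Longrightarrow> Suc r \<le> T ! r ! c"
proof (induction r)
  case 0
  then have "T ! 0 \<in> set T" "T ! 0 ! c \<in> set (T ! 0)" by auto
  then show ?case using T by (fastforce simp: SSYT_def)
next
  case (Suc r)
  have nu: "map length T = nu" using T by (simp add: SSYT_def)
  then have "nu ! Suc r = length (T ! Suc r)" "nu ! r = length (T ! r)" "length nu = length T"
    using Suc.prems by auto
  then have "c < length (T ! r)" using dec [of r] Suc.prems by simp
  then have "Suc r \<le> T ! r ! c" using Suc by simp
  moreover have "T ! r ! c < T ! Suc r ! c" using T Suc.prems by (simp add: SSYT_def)
  ultimately show ?case by simp
qed

text \<open>Empty top rows are kept, so that all configurations have exactly \<open>L\<close> rows.\<close>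

definition full_codomain :: "nat \<Rightarrow> nat \<Rightarrow> (nat set list \<times> nat list list) set" where
  "full_codomain L n = {(M, T). M \<in> binmat L n \<and> sorted_wrt dominated (rev M) \<and> T \<in> SSYT (map card M) L}"

lemma SSYT_length: "T \<in> SSYT (map card M) L \<Longrightarrow> length T = length M"
  by (metis (mono_tags, lifting) SSYT_def length_map mem_Collect_eq)

lemma strip_props:
  assumes "(M, T) \<in> full_codomain L n"
  shows "map length (strip [] T) = map card (strip {} M)"
    "(strip {} M, strip [] T) \<in> rho_codomain L n"
proof -
  have M: "length M = L" "\<forall>S\<in>set M. S \<subseteq> {1..n}" and ch: "sorted_wrt dominated (rev M)"
    and T: "T \<in> SSYT (map card M) L"
    using assms by (auto simp: full_codomain_def binmat_def)
  have fin: "\<forall>S\<in>set M. finite S" using M(2) by (meson finite_atLeastAtMost finite_subset)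
  have "map length (strip [] T) = strip 0 (map length T)" by (rule map_strip) simp
  also have "map length T = map card M" using T by (simp add: SSYT_def)
  also have "strip 0 (map card M) = map card (strip {} M)"
    using fin by (intro map_strip [symmetric]) simp
  finally show *: "map length (strip [] T) = map card (strip {} M)" .
  define k where "k = length M - length (strip {} M)"
  have len: "length (strip [] T) = length (strip {} M)" using arg_cong [OF *, of length] by simp
  have padM: "strip {} M @ replicate k {} = M" unfolding k_def by (rule strip_pad)
  have padT: "strip [] T @ replicate k [] = T"
    using strip_pad [of "[]" T] by (simp add: k_def len SSYT_length [OF T])
  have "map card M = map card (strip {} M) @ replicate k 0"
    by (subst padM [symmetric]) simp
  then have "strip [] T \<in> SSYT (map card (strip {} M)) L"
    using T padT SSYT_append_Nil [OF len, of k card L] by simp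
  moreover have chs: "sorted_wrt dominated (rev (strip {} M))"
  proof -
    have "sorted_wrt dominated (rev (strip {} M @ replicate k {}))" using ch padM by simp
    then show ?thesis by (simp add: sorted_wrt_append)
  qed
  \<comment> \<open>The last remaining row is nonempty and dominated by all others, so none of those
    is empty either.\<close>
  moreover have "{} \<notin> set (strip {} M)"
  proof (cases "strip {} M" rule: rev_cases)
    case (snoc Ms S)
    have "S \<noteq> {}" using strip_eq_snocD [OF snoc] .
    have "finite S" using fin padM snoc by (metis UnCI in_set_conv_decomp set_append)
    then have "card S > 0" using \<open>S \<noteq> {}\<close> by (simp add: card_gt_0_iff)
    moreover have "card S \<le> card R" if "R \<in> set Ms" for R
      using chs that snoc by (auto intro: dominated_card)
    ultimately show ?thesis using snoc \<open>S \<noteq> {}\<close> by fastforce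
  qed simp
  moreover have "\<forall>S\<in>set (strip {} M). S \<subseteq> {1..n}" using M(2) padM by (metis UnCI set_append)
  ultimately show "(strip {} M, strip [] T) \<in> rho_codomain L n"
    by (auto simp: rho_codomain_eq)
qed

lemma strip_bij:
  "bij_betw (\<lambda>(M, T). (strip {} M, strip [] T)) (full_codomain L n) (rho_codomain L n)"
proof (rule bij_betwI')
  fix z z' assume "z \<in> full_codomain L n" "z' \<in> full_codomain L n"
  moreover obtain M T M' T' where z: "z = (M, T)" "z' = (M', T')" by force
  ultimately have "length M = L" "length T = L" "length M' = L" "length T' = L"
    using SSYT_length [of T M L] SSYT_length [of T' M' L] by (auto simp: full_codomain_def binmat_def)
  then have "strip {} M = strip {} M' \<Longrightarrow> M = M'" "strip [] T = strip [] T' \<Longrightarrow> T = T'"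
    using strip_pad [of "{}" M] strip_pad [of "{}" M'] strip_pad [of "[]" T] strip_pad [of "[]" T'] by auto
  then show "(case z of (M, T) \<Rightarrow> (strip {} M, strip [] T)) =
      (case z' of (M, T) \<Rightarrow> (strip {} M, strip [] T)) \<longleftrightarrow> z = z'"
    using z by auto
next
  fix z assume "z \<in> full_codomain L n"
  then show "(case z of (M, T) \<Rightarrow> (strip {} M, strip [] T)) \<in> rho_codomain L n"
    using strip_props(2) by (cases z) simp
next
  fix z assume "z \<in> rho_codomain L n"
  then obtain M T where z: "z = (M, T)" and M: "\<forall>S\<in>set M. S \<subseteq> {1..n} \<and> S \<noteq> {}"
      "sorted_wrt dominated (rev M)" and T: "T \<in> SSYT (map card M) L"
    by (auto simp: rho_codomain_eq)
  have fin: "\<forall>S\<in>set M. finite S" using M(1) by (meson finite_atLeastAtMost finite_subset)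
  have lenT: "length T = length M" using SSYT_length [OF T] .
  have map: "map length T = map card M" using T by (simp add: SSYT_def)
  have Tne: "[] \<notin> set T"
  proof
    assume "[] \<in> set T"
    then have "0 \<in> set (map length T)" by force
    then show False unfolding map using M(1) fin by auto
  qed
  have "length M \<le> L"
  proof (cases "M = []")
    case False
    define r where "r = length M - 1"
    have r: "r < length T" "Suc r = length M" using False lenT by (auto simp: r_def)
    have ne: "0 < length (T ! r)" using Tne r by (metis length_greater_0_conv nth_mem)
    have "Suc r \<le> T ! r ! 0"
    proof (rule SSYT_entry_ge [OF T _ r(1) ne])
      fix i assume "Suc i < length (map card M)"
      then show "map card M ! Suc i \<le> map card M ! i"
        using M(2) by (simp add: sorted_rev_dominated_iff dominated_card)
    qed
    also have "T ! r ! 0 \<le> L"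
    proof -
      have "set (T ! r) \<subseteq> {1..L}" using T nth_mem [OF r(1)] by (simp add: SSYT_def)
      then show ?thesis using nth_mem [OF ne] by auto
    qed
    finally show ?thesis using r by simp
  qed simp
  define k where "k = L - length M"
  have "sorted_wrt dominated (replicate m {})" for m by (induction m) auto
  then have "(M @ replicate k {}, T @ replicate k []) \<in> full_codomain L n"
    using M \<open>length M \<le> L\<close> T SSYT_append_Nil [OF lenT, of k card L]
    by (auto simp: full_codomain_def binmat_def k_def sorted_wrt_append)
  moreover have "strip {} (M @ replicate k {}) = M" "strip [] (T @ replicate k []) = T"
    using M(1) Tne by (auto intro!: strip_replicate)
  ultimately show "\<exists>x\<in>full_codomain L n. z = (case x of (M, T) \<Rightarrow> (strip {} M, strip [] T))"
    unfolding z by (intro bexI [of _ "(M @ replicate k {}, T @ replicate k [])"]) auto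
qed

section \<open>Recording tableaux\<close>

lemma sorted_nth_le_iff:
  "sorted xs \<Longrightarrow> c < length xs \<Longrightarrow> xs ! c \<le> (k :: nat) \<longleftrightarrow> c < length (filter (\<lambda>x. x \<le> k) xs)"
proof (induction xs arbitrary: c)
  case (Cons a xs)
  show ?case
  proof (cases "a \<le> k")
    case True
    then show ?thesis using Cons by (cases c) auto
  next
    case False
    then have "\<forall>x\<in>set (a # xs). \<not> x \<le> k" using Cons.prems(1) by auto
    moreover from this have "filter (\<lambda>x. x \<le> k) (a # xs) = []" by (simp only: filter_empty_conv)
    ultimately show ?thesis using nth_mem [OF Cons.prems(2)] by (metis list.size(3) not_less0)
  qed
qed simp

lemma sorted_eq_by_counts:
  fixes xs ys :: "nat list"
  assumes "sorted xs" "sorted ys" "set xs \<subseteq> {1..L}" "set ys \<subseteq> {1..L}"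
    and eq: "\<And>k. k \<le> L \<Longrightarrow> length (filter (\<lambda>x. x \<le> k) xs) = length (filter (\<lambda>x. x \<le> k) ys)"
  shows "xs = ys"
proof -
  have "filter (\<lambda>x. x \<le> L) xs = xs" "filter (\<lambda>x. x \<le> L) ys = ys"
    using assms(3,4) by (auto intro!: filter_True)
  then have len: "length xs = length ys" using eq [of L] by simp
  show ?thesis
  proof (rule nth_equalityI [OF len])
    fix c assume c: "c < length xs"
    then have c': "c < length ys" using len by simp
    have "xs ! c \<le> L" "ys ! c \<le> L"
      using nth_mem [OF c] nth_mem [OF c'] assms(3,4) by auto
    moreover have "xs ! c \<le> k \<longleftrightarrow> ys ! c \<le> k" if "k \<le> L" for k
      using sorted_nth_le_iff [OF assms(1) c] sorted_nth_le_iff [OF assms(2) c'] eq [OF that] by simp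
    ultimately show "xs ! c = ys ! c" by (meson le_antisym order_refl)
  qed
qed

definition count_row :: "(nat \<Rightarrow> nat) \<Rightarrow> nat \<Rightarrow> nat list" where
  "count_row f L = concat (map (\<lambda>i. replicate (f i - f (i - 1)) i) [1..<L + 1])"

lemma count_row_Suc: "count_row f (Suc L) = count_row f L @ replicate (f (Suc L) - f L) (Suc L)"
  by (simp add: count_row_def)

lemma set_count_row: "set (count_row f L) \<subseteq> {1..L}"
  by (auto simp: count_row_def)

lemma sorted_count_row: "sorted (count_row f L)"
proof (induction L)
  case (Suc L)
  have "x \<le> Suc L" if "x \<in> set (count_row f L)" for x using set_count_row [of f L] that by fastforce
  then show ?case using Suc by (auto simp: count_row_Suc sorted_append)
qed (simp add: count_row_def)

text \<open>The multiplicities telescope; monotonicity of \<open>f\<close> makes the natural number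
  subtractions exact.\<close>

lemma count_count_row:
  "f 0 = 0 \<Longrightarrow> (\<And>i. i < L \<Longrightarrow> f i \<le> f (Suc i)) \<Longrightarrow> k \<le> L \<Longrightarrow>
   length (filter (\<lambda>x. x \<le> k) (count_row f L)) = f k"
proof (induction L arbitrary: k)
  case 0
  then show ?case by (simp add: count_row_def)
next
  case (Suc L)
  show ?case
  proof (cases "k = Suc L")
    case False
    then show ?thesis using Suc by (simp add: count_row_Suc)
  next
    case True
    have "length (filter (\<lambda>x. x \<le> L) (count_row f L)) = f L" using Suc by simp
    moreover have "filter (\<lambda>x. x \<le> L) (count_row f L) = count_row f L"
      "filter (\<lambda>x. x \<le> Suc L) (count_row f L) = count_row f L"
      using set_count_row [of f L] by (auto intro!: filter_True)
    ultimately show ?thesis using True Suc.prems(2) [of L] by (simp add: count_row_Suc)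
  qed
qed

lemma length_count_row:
  assumes "f 0 = 0" "\<And>i. i < L \<Longrightarrow> f i \<le> f (Suc i)" shows "length (count_row f L) = f L"
proof -
  have "filter (\<lambda>x. x \<le> L) (count_row f L) = count_row f L"
    using set_count_row [of f L] by (auto intro!: filter_True)
  then show ?thesis using count_count_row [of f L L] assms by simp
qed

lemma interlaced_iff_nth:
  "interlaced le ds as \<longleftrightarrow> length ds = Suc (length as) \<and>
     (\<forall>i < length as. le (ds ! i) (as ! i) \<and> le (as ! i) (ds ! Suc i))"
proof (induction le ds as rule: interlaced.induct)
  case (2 le d e ds a as)
  then show ?case by (auto simp: All_less_Suc2)
qed auto

lemma rhoN_eq: "B \<in> binmat L n \<Longrightarrow> rhoN n B = rev (insert_rows B)"
  using collapse_upto_eq [of B n "length B"] by (simp add: rhoN_def binmat_def)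

text \<open>\<open>Ncard\<close> numbers rows from the bottom starting at 1, insertion lists the top
  row first; hence the index \<open>k - r\<close>.\<close>

lemma Ncard_eq:
  assumes "B \<in> binmat L n" "k \<le> L" "1 \<le> r" "r \<le> k"
  shows "Ncard n B k r = map card (insert_rows (take k B)) ! (k - r)"
  using assms collapse_upto_eq [of B n k]
  by (auto simp: Ncard_def binmat_def nth_append rev_nth)

lemma sorted_insert_rows:
  assumes "\<forall>S\<in>set B. S \<subseteq> {1..n}"
  shows "sorted_wrt dominated (insert_rows B)"
  using assms
proof (induction B rule: rev_induct)
  case (snoc X B)
  have "finite X" "\<forall>S\<in>set (insert_rows B). finite S"
    using snoc.prems insert_rows_sub [of B n] by (auto simp: finite_subset [OF _ finite_atLeastAtMost])
  then show ?case using snoc sorted_insert_row by simp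
qed simp

lemma interlaced_insert_rows:
  assumes "B \<in> binmat L n" "k < L"
  shows "interlaced (\<le>) (map card (insert_rows (take (Suc k) B))) (map card (insert_rows (take k B)))"
proof -
  have B: "\<forall>S\<in>set B. S \<subseteq> {1..n}" "length B = L" using assms by (auto simp: binmat_def)
  have tk: "\<forall>S\<in>set (take k B). S \<subseteq> {1..n}" using B(1) by (auto dest: in_set_takeD)
  have "B ! k \<subseteq> {1..n}" using B assms(2) by simp
  then have "finite (B ! k)" "\<forall>S\<in>set (insert_rows (take k B)). finite S"
    using insert_rows_sub [OF tk] by (auto simp: finite_subset [OF _ finite_atLeastAtMost])
  then have "interlaced dominated (insert_row (B ! k) (insert_rows (take k B))) (insert_rows (take k B))"
    using sorted_insert_rows [OF tk] by (rule interlaced_insert_row)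
  then show ?thesis
    using B(2) assms(2) by (auto simp: take_Suc_conv_app_nth intro: interlaced_map dominated_card)
qed

text \<open>Consecutive shapes differ by a horizontal strip. The value 0 of \<open>Ncard\<close>
  outside its range extends the inequalities to \<open>r > k\<close>.\<close>

lemma Ncard_interlaced:
  assumes "B \<in> binmat L n" "k < L" "1 \<le> r"
  shows "Ncard n B k r \<le> Ncard n B (Suc k) r" "Ncard n B (Suc k) (Suc r) \<le> Ncard n B k r"
proof -
  have len: "length (insert_rows (take k B)) = k" using assms by (simp add: binmat_def)
  note il = interlaced_insert_rows [OF assms(1,2), unfolded interlaced_iff_nth length_map len]
  have *: "Ncard n B k r \<le> Ncard n B (Suc k) r \<and> Ncard n B (Suc k) (Suc r) \<le> Ncard n B k r"
  proof (cases "r \<le> k")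
    case True
    then have "Ncard n B k r = map card (insert_rows (take k B)) ! (k - r)"
      "Ncard n B (Suc k) r = map card (insert_rows (take (Suc k) B)) ! Suc (k - r)"
      "Ncard n B (Suc k) (Suc r) = map card (insert_rows (take (Suc k) B)) ! (k - r)"
      using assms Ncard_eq [of B L n] by (auto simp: Suc_diff_le)
    moreover have "k - r < k" using True assms(3) by simp
    ultimately show ?thesis using il by metis
  qed (simp add: Ncard_def)
  then show "Ncard n B k r \<le> Ncard n B (Suc k) r" "Ncard n B (Suc k) (Suc r) \<le> Ncard n B k r" by auto
qed

lemma rhoQ_rows_eq:
  "rhoQ_rows n B = map (\<lambda>r. count_row (\<lambda>i. Ncard n B i (Suc r)) (length B)) [0..<length B]"
proof -
  have "[1..<length B + 1] = map Suc [0..<length B]" by (simp add: map_Suc_upt del: upt_Suc)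
  then show ?thesis
    unfolding rhoQ_rows_def Let_def count_row_def by (simp add: o_def del: upt_Suc)
qed

lemma count_rhoQ_rows:
  assumes "B \<in> binmat L n" "r < L" "k \<le> L"
  shows "length (filter (\<lambda>x. x \<le> k) (rhoQ_rows n B ! r)) = Ncard n B k (Suc r)"
proof -
  have "length B = L" using assms by (simp add: binmat_def)
  moreover have "length (filter (\<lambda>x. x \<le> k) (count_row (\<lambda>i. Ncard n B i (Suc r)) L)) = Ncard n B k (Suc r)"
  proof (rule count_count_row)
    show "Ncard n B 0 (Suc r) = 0" by (simp add: Ncard_def)
    show "Ncard n B i (Suc r) \<le> Ncard n B (Suc i) (Suc r)" if "i < L" for i
      using Ncard_interlaced(1) [OF assms(1) that] by simp
  qed (rule assms(3))
  ultimately show ?thesis using assms(2) by (simp add: rhoQ_rows_eq)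
qed

lemma rhoQ_rows_SSYT:
  assumes B: "B \<in> binmat L n"
  shows "rhoQ_rows n B \<in> SSYT (map card (rhoN n B)) L"
proof -
  have len: "length B = L" using B by (simp add: binmat_def)
  define f where "f = (\<lambda>r i. Ncard n B i (Suc r))"
  have f0: "f r 0 = 0" for r by (simp add: f_def Ncard_def)
  have fmono: "f r i \<le> f r (Suc i)" and fstrip: "f (Suc r) (Suc i) \<le> f r i" if "i < L" for r i
    using Ncard_interlaced [OF B that, of "Suc r"] by (auto simp: f_def)
  define T where "T = map (\<lambda>r. count_row (f r) L) [0..<L]"
  have T: "rhoQ_rows n B = T" by (simp add: rhoQ_rows_eq len T_def f_def)
  have lenr: "length (count_row (f r) L) = f r L" for r
    using f0 fmono by (rule length_count_row)
  have "map length T = map card (rhoN n B)"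
  proof (rule nth_equalityI)
    show "length (map length T) = length (map card (rhoN n B))"
      using rhoN_eq [OF B] len by (simp add: T_def)
    fix r assume "r < length (map length T)"
    then have r: "r < L" by (simp add: T_def)
    then have "map length T ! r = f r L" by (simp add: T_def lenr)
    also have "\<dots> = card (rhoN n B ! r)" using r by (simp add: f_def Ncard_def rhoN_def len)
    also have "\<dots> = map card (rhoN n B) ! r" using r rhoN_eq [OF B] len by simp
    finally show "map length T ! r = map card (rhoN n B) ! r" .
  qed
  moreover have "\<forall>row\<in>set T. sorted row \<and> set row \<subseteq> {1..L}"
    using set_count_row sorted_count_row by (auto simp: T_def)
  moreover have "T ! r ! c < T ! Suc r ! c" if "Suc r < length T" "c < length (T ! Suc r)" for r c
  proof -
    have r: "Suc r < L" "r < L" using that by (auto simp: T_def)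
    let ?xs = "count_row (f (Suc r)) L" and ?ys = "count_row (f r) L"
    have c: "c < length ?xs" using that r by (simp add: T_def)
    define v where "v = ?xs ! c"
    have "v \<in> {1..L}" using set_count_row nth_mem [OF c] unfolding v_def by blast
    then obtain i where i: "v = Suc i" "i < L" by (cases v) auto
    \<comment> \<open>An entry \<open>Suc i\<close> in column \<open>c\<close> means that more than
      \<open>c\<close> entries of the upper row are at most \<open>Suc i\<close>. The strip
      inequality then gives more than \<open>c\<close> entries at most \<open>i\<close> in the row
      below.\<close>
    have "c < length (filter (\<lambda>x. x \<le> v) ?xs)"
      using sorted_nth_le_iff [OF sorted_count_row c, of v] by (simp add: v_def)
    also have "\<dots> = f (Suc r) (Suc i)"
      using f0 fmono i by (simp add: count_count_row)
    also have "\<dots> \<le> f r i" using fstrip i by blast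
    also have "f r i = length (filter (\<lambda>x. x \<le> i) ?ys)"
      using f0 fmono i by (simp add: count_count_row)
    finally have ci: "c < length (filter (\<lambda>x. x \<le> i) ?ys)" .
    then have "c < length ?ys" using length_filter_le [of "\<lambda>x. x \<le> i" ?ys] by linarith
    then have "?ys ! c \<le> i" using ci sorted_nth_le_iff [OF sorted_count_row] by blast
    then show ?thesis using r i(1) by (simp add: T_def v_def)
  qed
  ultimately show ?thesis unfolding T SSYT_def by blast
qed

section \<open>Inverting the iterated insertion\<close>

lemma insert_rows_inj:
  "length B = length B' \<Longrightarrow> \<forall>S\<in>set B. S \<subseteq> {1..n} \<Longrightarrow> \<forall>S\<in>set B'. S \<subseteq> {1..n} \<Longrightarrow>
   insert_rows B = insert_rows B' \<Longrightarrow>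
   (\<And>k. k < length B \<Longrightarrow> map card (insert_rows (take k B)) = map card (insert_rows (take k B'))) \<Longrightarrow> B = B'"
proof (induction B arbitrary: B' rule: rev_induct)
  case (snoc X B)
  obtain B'' X' where B': "B' = B'' @ [X']" using snoc.prems(1) by (cases B' rule: rev_cases) auto
  have len: "length B = length B''" using snoc.prems(1) B' by simp
  have sub: "\<forall>S\<in>set B. S \<subseteq> {1..n}" "\<forall>S\<in>set B''. S \<subseteq> {1..n}" "X \<subseteq> {1..n}" "X' \<subseteq> {1..n}"
    using snoc.prems(2,3) B' by auto
  have "X = X' \<and> insert_rows B = insert_rows B''"
  proof (rule insert_row_inj)
    show "insert_row X (insert_rows B) = insert_row X' (insert_rows B'')"
      using snoc.prems(4) B' by simp
    show "map card (insert_rows B) = map card (insert_rows B'')"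
      using snoc.prems(5) [of "length B"] B' len by simp
    show "finite X" "finite X'" using sub(3,4) by (simp_all add: finite_subset [OF _ finite_atLeastAtMost])
    show "\<forall>A\<in>set (insert_rows B). finite A" "\<forall>A\<in>set (insert_rows B''). finite A"
      using insert_rows_sub [OF sub(1)] insert_rows_sub [OF sub(2)]
      by (meson finite_atLeastAtMost finite_subset)+
  qed
  moreover from this have "B = B''"
  proof (intro snoc.IH len sub)
    fix k assume "k < length B"
    then show "map card (insert_rows (take k B)) = map card (insert_rows (take k B''))"
      using snoc.prems(5) [of k] B' len by simp
  qed simp
  ultimately show ?case by (simp add: B')
qed simp

text \<open>\<open>lam k\<close> prescribes the row sizes after \<open>k\<close> insertions, top row
  first; \<open>insert_row_surj\<close> peels off the last insertion.\<close>

lemma insert_rows_surj: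
  "(\<And>k. k < L \<Longrightarrow> interlaced (\<le>) (lam (Suc k)) (lam k)) \<Longrightarrow> lam 0 = [] \<Longrightarrow>
   sorted_wrt dominated Ms \<Longrightarrow> \<forall>S\<in>set Ms. S \<subseteq> {1..n} \<Longrightarrow> map card Ms = lam L \<Longrightarrow>
   \<exists>B \<in> binmat L n. insert_rows B = Ms \<and> (\<forall>k\<le>L. map card (insert_rows (take k B)) = lam k)"
proof (induction L arbitrary: Ms)
  case 0
  then show ?case by (auto simp: binmat_def)
next
  case (Suc L)
  have fin: "\<forall>S\<in>set Ms. finite S" using Suc.prems(4) by (meson finite_atLeastAtMost finite_subset)
  obtain X As where X: "insert_row X As = Ms" "map card As = lam L" "sorted_wrt dominated As"
     "finite X" "\<forall>A\<in>set As. finite A"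
  proof -
    have "\<exists>X As. insert_row X As = Ms \<and> map card As = lam L \<and> sorted_wrt dominated As \<and>
     finite X \<and> (\<forall>A\<in>set As. finite A)"
      using Suc.prems(1) [of L] Suc.prems(5) by (intro insert_row_surj Suc.prems(3) fin) simp
    then show ?thesis using that by blast
  qed
  have "X \<union> \<Union>(set As) \<subseteq> {1..n}"
    using Union_insert_row [OF X(4,5)] Suc.prems(4) unfolding X(1) by blast
  then have sub: "X \<subseteq> {1..n}" "\<forall>A\<in>set As. A \<subseteq> {1..n}" by blast+
  have "\<exists>B \<in> binmat L n. insert_rows B = As \<and> (\<forall>k\<le>L. map card (insert_rows (take k B)) = lam k)"
    by (rule Suc.IH) (use Suc.prems(1,2) X sub in auto)
  then obtain B where B: "B \<in> binmat L n" "insert_rows B = As"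
     "\<forall>k\<le>L. map card (insert_rows (take k B)) = lam k" by blast
  have len: "length B = L" using B(1) by (simp add: binmat_def)
  have "map card (insert_rows (take k (B @ [X]))) = lam k" if "k \<le> Suc L" for k
  proof (cases "k = Suc L")
    case True
    then show ?thesis using len B(2) X(1) Suc.prems(5) by simp
  qed (use B(3) that len in simp)
  moreover have "B @ [X] \<in> binmat (Suc L) n" using B(1) sub by (auto simp: binmat_def)
  moreover have "insert_rows (B @ [X]) = Ms" using B(2) X(1) by simp
  ultimately show ?case by blast
qed

lemma rho_full_bij:
  "bij_betw (\<lambda>B. (rhoN n B, rhoQ_rows n B)) (binmat L n) (full_codomain L n)"
proof (rule bij_betwI')
  fix B B' assume B: "B \<in> binmat L n" and B': "B' \<in> binmat L n"
  have "B = B'" if eq: "rhoN n B = rhoN n B'" "rhoQ_rows n B = rhoQ_rows n B'"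
  proof (rule insert_rows_inj)
    show len: "length B = length B'" and "\<forall>S\<in>set B. S \<subseteq> {1..n}" "\<forall>S\<in>set B'. S \<subseteq> {1..n}"
      using B B' by (auto simp: binmat_def)
    show "insert_rows B = insert_rows B'" using eq(1) rhoN_eq [OF B] rhoN_eq [OF B'] by simp
    fix k assume "k < length B"
    then have k: "k < L" using B by (simp add: binmat_def)
    have lens: "length (insert_rows (take k B)) = k" "length (insert_rows (take k B')) = k"
      using k B B' by (auto simp: binmat_def)
    show "map card (insert_rows (take k B)) = map card (insert_rows (take k B'))"
    proof (rule nth_equalityI)
      fix i assume "i < length (map card (insert_rows (take k B)))"
      then have i: "i < k" using lens by simp
      define r where "r = k - Suc i"
      have r: "Suc r \<le> k" "k - Suc r = i" "r < L" using i k by (auto simp: r_def)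
      have "Ncard n B k (Suc r) = Ncard n B' k (Suc r)"
        using count_rhoQ_rows [OF B r(3), of k] count_rhoQ_rows [OF B' r(3), of k] k eq(2) by simp
      then show "map card (insert_rows (take k B)) ! i = map card (insert_rows (take k B')) ! i"
        using Ncard_eq [OF B _ _ r(1)] Ncard_eq [OF B' _ _ r(1)] k r(2) by simp
    qed (use lens in simp)
  qed
  then show "((rhoN n B, rhoQ_rows n B) = (rhoN n B', rhoQ_rows n B')) = (B = B')" by auto
next
  fix B assume B: "B \<in> binmat L n"
  then have sub: "\<forall>S\<in>set B. S \<subseteq> {1..n}" "length B = L" by (auto simp: binmat_def)
  show "(rhoN n B, rhoQ_rows n B) \<in> full_codomain L n"
    using rhoQ_rows_SSYT [OF B] sorted_insert_rows [OF sub(1)] insert_rows_sub [OF sub(1)] sub(2)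
    by (simp add: full_codomain_def binmat_def rhoN_eq [OF B])
next
  fix z assume "z \<in> full_codomain L n"
  then obtain M T where z: "z = (M, T)" and M: "length M = L" "\<forall>S\<in>set M. S \<subseteq> {1..n}"
     "sorted_wrt dominated (rev M)" and T: "T \<in> SSYT (map card M) L"
    by (auto simp: full_codomain_def binmat_def)
  \<comment> \<open>The intermediate sizes are read off \<open>T\<close>: \<open>F k r\<close> is
    the length of row \<open>r\<close> restricted to entries up to \<open>k\<close>. Listing only
    \<open>k\<close> rows in \<open>lam k\<close> loses nothing, since such entries lie in the
    lowest \<open>k\<close> rows.\<close>
  define F where "F = (\<lambda>k r. length (filter (\<lambda>x. x \<le> k) (T ! r)))"
  define lam where "lam = (\<lambda>k. map (F k) (rev [0..<k]))"
  have lenT: "length T = L" using SSYT_length [OF T] M(1) by simp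
  have shape: "map length T = map card M" using T by (simp add: SSYT_def)
  have row: "length (T ! r) = card (M ! r)" if "r < L" for r
    using arg_cong [OF shape, of "\<lambda>xs. xs ! r"] that lenT M(1) by simp
  have Trow: "sorted (T ! r)" "set (T ! r) \<subseteq> {1..L}" if "r < L" for r
    using T nth_mem [of r T] that lenT by (auto simp: SSYT_def)
  have dec: "card (M ! Suc r) \<le> card (M ! r)" if "Suc r < L" for r
    using M(1,3) that by (simp add: sorted_rev_dominated_iff dominated_card)
  have entry: "Suc r \<le> x" if r: "r < L" and x: "x \<in> set (T ! r)" for r x
  proof -
    obtain c where "c < length (T ! r)" "x = T ! r ! c" using x by (metis in_set_conv_nth)
    then show ?thesis using SSYT_entry_ge [OF T, of r c] dec M(1) r lenT by simp
  qed
  have F0: "F k r = 0" if "k \<le> r" "r < L" for k r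
    using entry [OF that(2)] that(1) by (fastforce simp: F_def filter_empty_conv)
  have FL: "F L r = card (M ! r)" if "r < L" for r
  proof -
    have "filter (\<lambda>x. x \<le> L) (T ! r) = T ! r" using Trow(2) [OF that] by (auto intro!: filter_True)
    then show ?thesis using row [OF that] by (simp add: F_def)
  qed
  have Fmono: "F k r \<le> F (Suc k) r" for k r
  proof -
    have "length (filter (\<lambda>x. x \<le> k) xs) \<le> length (filter (\<lambda>x. x \<le> Suc k) xs)" for xs
      by (induction xs) auto
    then show ?thesis by (simp add: F_def)
  qed
  have Fstrip: "F (Suc k) (Suc r) \<le> F k r" if "Suc r < L" for k r
  proof (rule ccontr)
    \<comment> \<open>Column \<open>F k r\<close> is the first one of row \<open>r\<close> with an
      entry above \<open>k\<close>, but the entry over it would be at most \<open>Suc k\<close>,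
      against strictness.\<close>
    assume "\<not> ?thesis"
    then have lt: "F k r < F (Suc k) (Suc r)" by simp
    then have c: "F k r < length (T ! Suc r)"
      using length_filter_le [of "\<lambda>x. x \<le> Suc k" "T ! Suc r"] unfolding F_def by linarith
    then have c': "F k r < length (T ! r)" using dec [OF that] row [OF that] row [of r] that by simp
    have "T ! Suc r ! F k r \<le> Suc k"
      using sorted_nth_le_iff [OF Trow(1) [OF that] c] lt by (simp add: F_def)
    moreover have "T ! r ! F k r < T ! Suc r ! F k r" using T c that lenT by (simp add: SSYT_def)
    ultimately have "T ! r ! F k r \<le> k" by simp
    then have "F k r < length (filter (\<lambda>x. x \<le> k) (T ! r))"
      using sorted_nth_le_iff [OF Trow(1) c'] that by simp
    then show False by (simp add: F_def)
  qed
  have il: "interlaced (\<le>) (lam (Suc k)) (lam k)" if "k < L" for k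
  proof -
    have "lam (Suc k) ! i \<le> lam k ! i \<and> lam k ! i \<le> lam (Suc k) ! Suc i" if i: "i < k" for i
    proof -
      define r where "r = k - Suc i"
      have "lam k ! i = F k r" "lam (Suc k) ! Suc i = F (Suc k) r" "lam (Suc k) ! i = F (Suc k) (Suc r)"
        using i by (auto simp: lam_def rev_nth r_def Suc_diff_Suc simp del: upt_Suc)
      moreover have "Suc r < L" using i \<open>k < L\<close> by (simp add: r_def)
      ultimately show ?thesis using Fmono Fstrip by simp
    qed
    then show ?thesis by (simp add: interlaced_iff_nth lam_def)
  qed
  have "\<exists>B \<in> binmat L n. insert_rows B = rev M \<and> (\<forall>k\<le>L. map card (insert_rows (take k B)) = lam k)"
  proof (rule insert_rows_surj)
    have "map (F L) [0..<L] = map card M"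
      using FL M(1) by (intro nth_equalityI) auto
    then show "map card (rev M) = lam L" by (simp add: lam_def flip: rev_map)
  qed (use il M in \<open>auto simp: lam_def\<close>)
  then obtain B where B: "B \<in> binmat L n" "insert_rows B = rev M"
      "\<forall>k\<le>L. map card (insert_rows (take k B)) = lam k" by blast
  have N: "Ncard n B k (Suc r) = F k r" if "k \<le> L" "r < L" for k r
  proof (cases "Suc r \<le> k")
    case True
    then have "Ncard n B k (Suc r) = lam k ! (k - Suc r)"
      using Ncard_eq [OF B(1) that(1), of "Suc r"] B(3) that(1) by simp
    then show ?thesis using True by (simp add: lam_def rev_nth)
  next
    case False
    then show ?thesis using F0 that(2) by (simp add: Ncard_def)
  qed
  have lenB: "length B = L" using B(1) by (simp add: binmat_def)
  have "rhoQ_rows n B = T"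
  proof (rule nth_equalityI)
    show "length (rhoQ_rows n B) = length T" by (simp add: rhoQ_rows_eq lenB lenT)
    fix r assume "r < length (rhoQ_rows n B)"
    then have r: "r < L" by (simp add: rhoQ_rows_eq lenB)
    show "rhoQ_rows n B ! r = T ! r"
    proof (rule sorted_eq_by_counts)
      show "sorted (rhoQ_rows n B ! r)" "set (rhoQ_rows n B ! r) \<subseteq> {1..L}"
        using r set_count_row sorted_count_row by (simp_all add: rhoQ_rows_eq lenB)
      show "length (filter (\<lambda>x. x \<le> k) (rhoQ_rows n B ! r)) = length (filter (\<lambda>x. x \<le> k) (T ! r))"
        if "k \<le> L" for k
        using count_rhoQ_rows [OF B(1) r that] N [OF that r] by (simp add: F_def)
    qed (use Trow r in auto)
  qed
  then show "\<exists>B\<in>binmat L n. z = (rhoN n B, rhoQ_rows n B)"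
    using B(1,2) rhoN_eq [OF B(1)] z by (intro bexI [of _ B]) auto
qed

lemma weight_insert_rows:
  fixes x :: "nat \<Rightarrow> 'a::comm_monoid_mult"
  shows "\<forall>S\<in>set B. S \<subseteq> {1..n} \<Longrightarrow> weight x (insert_rows B) = weight x B"
proof (induction B rule: rev_induct)
  case (snoc X B)
  have "finite X" "\<forall>S\<in>set (insert_rows B). finite S"
    using snoc.prems insert_rows_sub [of B n] by (auto simp: finite_subset [OF _ finite_atLeastAtMost])
  then have "weight x (insert_rows (B @ [X])) = weight x (X # insert_rows B)"
    by (simp add: weight_insert_row)
  then show ?case using snoc by (simp add: weight_def mult.commute)
qed simp

lemma weight_rev: "weight x (rev B) = weight x B"
  by (induction B) (simp_all add: weight_def mult.commute)

theorem theorem4p19: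
  fixes L n :: nat
  assumes "0 < L" and "0 < n"
  shows "bij_betw (rho n) (binmat L n) (rho_codomain L n) \<and>
         (\<forall>(x :: nat \<Rightarrow> 'a::comm_monoid_mult). \<forall>B \<in> binmat L n. weight x B = weight x (rhoN n B))"
proof (intro conjI allI ballI)
  \<comment> \<open>Both deletions of empty top rows, of balls and of tableau entries, are instances
    of \<open>strip\<close>.\<close>
  have "rho n = (\<lambda>(M, T). (strip {} M, strip [] T)) \<circ> (\<lambda>B. (rhoN n B, rhoQ_rows n B))"
    by (auto simp: fun_eq_iff rho_def rhoQ_def strip_top_def strip_def)
  then show "bij_betw (rho n) (binmat L n) (rho_codomain L n)"
    using bij_betw_trans [OF rho_full_bij strip_bij] by simp
next
  fix x :: "nat \<Rightarrow> 'a" and B assume "B \<in> binmat L n"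
  then show "weight x B = weight x (rhoN n B)"
    using weight_insert_rows [of B n x] by (simp add: rhoN_eq weight_rev binmat_def)
qed

end
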